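(* Let $R$ be a ring and let $G$ be a group. (1) If $R$ is weakly $2$-primal and strongly unit nil-clean and $G$ is a locally finite group, then the group ring $RG$ is strongly unit nil-clean. (2) If $RG$ is a strongly unit nil-clean ring, then $R$ is strongly unit nil-clean and $G$ is a torsion group.
   Context: Rings are associative with identity, not necessarily commutative. An element of a ring is strongly nil-clean if it is the sum of an idempotent $e$ and a nilpotent $b$ with $eb=be$. A ring $R$ is strongly unit nil-clean if for every $a\in R$ there is a unit $u\in R$ such that $ua$ is strongly nil-clean. $\mathrm{Nil}(R)$ denotes the set of nilpotent elements of $R$, and $L(R)$ the Levitzki radical, i.e. the largest locally nilpotent two-sided ideal of $R$ (an ideal is locally nilpotent if every finite subset of it generates a nilpotent subring without identity). $R$ is weakly $2$-primal if $\mathrm{Nil}(R)=L(R)$. A group is locally finite if each of its finitely generated subgroups is finite, and torsion if each of its elements has finite order.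
   Formalization: Part (2) is stated for a nonzero ring R (1 ≠ 0); for R = 0 it fails, since then RG = 0 is strongly unit nil-clean for every group G, including the non-torsion group of integers. *)

theory Defs
  imports "HOL-Algebra.Algebra"
begin

definition nilpotent :: "('a, 'm) ring_scheme \<Rightarrow> 'a \<Rightarrow> bool" where
  "nilpotent R b \<longleftrightarrow> b \<in> carrier R \<and> (\<exists>n::nat. n > 0 \<and> b [^]\<^bsub>R\<^esub> n = \<zero>\<^bsub>R\<^esub>)"

definition nilpotents :: "('a, 'm) ring_scheme \<Rightarrow> 'a set" where
  "nilpotents R = {b. nilpotent R b}"

definition strongly_nil_clean :: "('a, 'm) ring_scheme \<Rightarrow> 'a \<Rightarrow> bool" where
  "strongly_nil_clean R a \<longleftrightarrow>
     (\<exists>e\<in>carrier R. \<exists>b\<in>carrier R.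
        e \<otimes>\<^bsub>R\<^esub> e = e \<and> nilpotent R b \<and> e \<otimes>\<^bsub>R\<^esub> b = b \<otimes>\<^bsub>R\<^esub> e \<and> a = e \<oplus>\<^bsub>R\<^esub> b)"

definition strongly_unit_nil_clean :: "('a, 'm) ring_scheme \<Rightarrow> bool" where
  "strongly_unit_nil_clean R \<longleftrightarrow>
     (\<forall>a\<in>carrier R. \<exists>u\<in>Units R. strongly_nil_clean R (u \<otimes>\<^bsub>R\<^esub> a))"

text \<open>Unlike \<open>generate_ring\<close>, the subring generated here need not contain \<open>\<one>\<close>.\<close>

inductive_set generate_rng :: "('a, 'm) ring_scheme \<Rightarrow> 'a set \<Rightarrow> 'a set"
  for R and H where
    zero: "\<zero>\<^bsub>R\<^esub> \<in> generate_rng R H"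
  | incl: "h \<in> H \<Longrightarrow> h \<in> generate_rng R H"
  | a_inv: "h \<in> generate_rng R H \<Longrightarrow> \<ominus>\<^bsub>R\<^esub> h \<in> generate_rng R H"
  | eng_add: "\<lbrakk> h1 \<in> generate_rng R H; h2 \<in> generate_rng R H \<rbrakk> \<Longrightarrow> h1 \<oplus>\<^bsub>R\<^esub> h2 \<in> generate_rng R H"
  | eng_mult: "\<lbrakk> h1 \<in> generate_rng R H; h2 \<in> generate_rng R H \<rbrakk> \<Longrightarrow> h1 \<otimes>\<^bsub>R\<^esub> h2 \<in> generate_rng R H"

text \<open>\<open>S\<close> is nilpotent if \<open>S\<^sup>n = 0\<close> for some \<open>n \<ge> 1\<close>, i.e. if all products of \<open>n\<close>
  elements of \<open>S\<close> vanish.\<close>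

definition nilpotent_subrng :: "('a, 'm) ring_scheme \<Rightarrow> 'a set \<Rightarrow> bool" where
  "nilpotent_subrng R S \<longleftrightarrow>
     (\<exists>n>0. \<forall>xs. set xs \<subseteq> S \<and> length xs = n \<longrightarrow> foldr (\<otimes>\<^bsub>R\<^esub>) xs \<one>\<^bsub>R\<^esub> = \<zero>\<^bsub>R\<^esub>)"

definition locally_nilpotent :: "('a, 'm) ring_scheme \<Rightarrow> 'a set \<Rightarrow> bool" where
  "locally_nilpotent R I \<longleftrightarrow>
     (\<forall>F. finite F \<and> F \<subseteq> I \<longrightarrow> nilpotent_subrng R (generate_rng R F))"

text \<open>\<open>L\<close> is the Levitzki radical \<open>L(R)\<close>: the largest locally nilpotent two-sided ideal.
  It is unique by antisymmetry of inclusion.\<close>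

definition is_levitzki_radical :: "('a, 'm) ring_scheme \<Rightarrow> 'a set \<Rightarrow> bool" where
  "is_levitzki_radical R L \<longleftrightarrow>
     ideal L R \<and> locally_nilpotent R L \<and>
     (\<forall>I. ideal I R \<and> locally_nilpotent R I \<longrightarrow> I \<subseteq> L)"

definition weakly_2_primal :: "('a, 'm) ring_scheme \<Rightarrow> bool" where
  "weakly_2_primal R \<longleftrightarrow> is_levitzki_radical R (nilpotents R)"

definition locally_finite_group :: "('g, 'n) monoid_scheme \<Rightarrow> bool" where
  "locally_finite_group G \<longleftrightarrow> (\<forall>F. finite F \<and> F \<subseteq> carrier G \<longrightarrow> finite (generate G F))"

text \<open>In HOL-Algebra, \<open>ord x = 0\<close> encodes infinite order.\<close>

definition torsion_group :: "('g, 'n) monoid_scheme \<Rightarrow> bool" where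
  "torsion_group G \<longleftrightarrow> (\<forall>x\<in>carrier G. group.ord G x \<noteq> 0)"

definition gr_supp :: "('a, 'm) ring_scheme \<Rightarrow> ('g, 'n) monoid_scheme \<Rightarrow> ('g \<Rightarrow> 'a) \<Rightarrow> 'g set" where
  "gr_supp R G f = {g \<in> carrier G. f g \<noteq> \<zero>\<^bsub>R\<^esub>}"

text \<open>The formal sum \<open>\<Sum>\<^sub>g f(g) g\<close> is represented by its finitely supported coefficient function
  \<open>f\<close> (undefined outside \<open>carrier G\<close>). In the product, the coefficient at \<open>x\<close> is the sum of
  \<open>f(y) h(z)\<close> over all \<open>y\<close>, \<open>z\<close> with \<open>y z = x\<close>, where only \<open>y\<close> in the support of \<open>f\<close> contribute.\<close>

definition group_ring :: "('a, 'm) ring_scheme \<Rightarrow> ('g, 'n) monoid_scheme \<Rightarrow> ('g \<Rightarrow> 'a) ring" where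
  "group_ring R G =
     \<lparr> carrier = {f \<in> carrier G \<rightarrow>\<^sub>E carrier R. finite (gr_supp R G f)},
       monoid.mult = (\<lambda>f h. \<lambda>x\<in>carrier G.
                 \<Oplus>\<^bsub>R\<^esub>y\<in>gr_supp R G f. f y \<otimes>\<^bsub>R\<^esub> h (inv\<^bsub>G\<^esub> y \<otimes>\<^bsub>G\<^esub> x)),
       one = (\<lambda>x\<in>carrier G. if x = \<one>\<^bsub>G\<^esub> then \<one>\<^bsub>R\<^esub> else \<zero>\<^bsub>R\<^esub>),
       ring.zero = (\<lambda>x\<in>carrier G. \<zero>\<^bsub>R\<^esub>),
       ring.add = (\<lambda>f h. \<lambda>x\<in>carrier G. f x \<oplus>\<^bsub>R\<^esub> h x) \<rparr>"



lemma (in abelian_monoid) finsum_swap: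
  assumes "finite A" "finite B" "\<And>a b. \<lbrakk>a \<in> A; b \<in> B\<rbrakk> \<Longrightarrow> f a b \<in> carrier G"
  shows "(\<Oplus>a\<in>A. \<Oplus>b\<in>B. f a b) = (\<Oplus>b\<in>B. \<Oplus>a\<in>A. f a b)"
  using assms(1,3)
proof (induction A)
  case empty
  then show ?case by simp
next
  case (insert x A)
  have 1: "(\<lambda>b. f x b) \<in> B \<rightarrow> carrier G" using insert.prems by auto
  have 2: "(\<lambda>a. \<Oplus>b\<in>B. f a b) \<in> A \<rightarrow> carrier G"
    using insert.prems by (auto intro!: finsum_closed)
  have 3: "(\<lambda>b. \<Oplus>a\<in>A. f a b) \<in> B \<rightarrow> carrier G"
    using insert.prems by (auto intro!: finsum_closed)
  have 4: "(\<Oplus>b\<in>B. f x b) \<in> carrier G" using 1 by (rule finsum_closed)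
  have "(\<Oplus>a\<in>insert x A. \<Oplus>b\<in>B. f a b) = (\<Oplus>b\<in>B. f x b) \<oplus> (\<Oplus>a\<in>A. \<Oplus>b\<in>B. f a b)"
    using insert.hyps 2 4 by (simp add: finsum_insert)
  also have "\<dots> = (\<Oplus>b\<in>B. f x b \<oplus> (\<Oplus>a\<in>A. f a b))"
    using insert.IH insert.prems finsum_addf[OF 1 3] by simp
  also have "\<dots> = (\<Oplus>b\<in>B. \<Oplus>a\<in>insert x A. f a b)"
    by (rule finsum_cong') (use insert in \<open>auto intro!: finsum_closed finsum_insert[symmetric]\<close>)
  finally show ?case .
qed

locale group_ring_setup = R?: ring R + G?: group G for R (structure) and G (structure)
begin

abbreviation "RG \<equiv> group_ring R G"
abbreviation "supp \<equiv> gr_supp R G"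

lemma coeff_closed: "f \<in> carrier RG \<Longrightarrow> g \<in> carrier G \<Longrightarrow> f g \<in> carrier R"
  by (auto simp: group_ring_def)
lemma finite_supp: "f \<in> carrier RG \<Longrightarrow> finite (supp f)"
  by (auto simp: group_ring_def)
lemma supp_in_carrier: "g \<in> supp f \<Longrightarrow> g \<in> carrier G" by (auto simp: gr_supp_def)

lemma group_ring_memI: assumes "finite A" "\<And>g. g \<in> carrier G \<Longrightarrow> f g \<in> carrier R"
  "\<And>g. g \<in> carrier G \<Longrightarrow> g \<notin> A \<Longrightarrow> f g = \<zero>\<^bsub>R\<^esub>" "f \<in> extensional (carrier G)"
  shows "f \<in> carrier RG"
proof -
  have "supp f \<subseteq> A" using assms by (auto simp: gr_supp_def)
  then show ?thesis using assms finite_subset by (auto simp: group_ring_def PiE_def)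
qed

lemma group_ring_eqI: assumes "f \<in> carrier RG" "h \<in> carrier RG" "\<And>x. x \<in> carrier G \<Longrightarrow> f x = h x" shows "f = h"
  using assms by (auto simp: group_ring_def intro: PiE_ext)

lemma mult_coeff:
  assumes "f \<in> carrier RG" "h \<in> carrier RG" "x \<in> carrier G" "finite A" "supp f \<subseteq> A" "A \<subseteq> carrier G"
  shows "(f \<otimes>\<^bsub>RG\<^esub> h) x = (\<Oplus>\<^bsub>R\<^esub>y\<in>A. f y \<otimes>\<^bsub>R\<^esub> h (inv\<^bsub>G\<^esub> y \<otimes>\<^bsub>G\<^esub> x))"
proof -
  have "(\<Oplus>\<^bsub>R\<^esub>y\<in>supp f. f y \<otimes>\<^bsub>R\<^esub> h (inv\<^bsub>G\<^esub> y \<otimes>\<^bsub>G\<^esub> x)) = (\<Oplus>\<^bsub>R\<^esub>y\<in>A. f y \<otimes>\<^bsub>R\<^esub> h (inv\<^bsub>G\<^esub> y \<otimes>\<^bsub>G\<^esub> x))"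
  proof (rule R.add.finprod_mono_neutral_cong_left[OF assms(4,5)])
    fix i assume "i \<in> A - supp f"
    then have "i \<in> carrier G" "f i = \<zero>\<^bsub>R\<^esub>" using assms by (auto simp: gr_supp_def)
    then show "f i \<otimes>\<^bsub>R\<^esub> h (inv\<^bsub>G\<^esub> i \<otimes>\<^bsub>G\<^esub> x) = \<zero>\<^bsub>R\<^esub>" using assms coeff_closed by auto
  qed (use assms coeff_closed in auto)
  then show ?thesis using assms by (simp add: group_ring_def)
qed

lemma mult_in:
  assumes "f \<in> carrier RG" "h \<in> carrier RG"
  shows "f \<otimes>\<^bsub>RG\<^esub> h \<in> carrier RG"
proof (rule group_ring_memI[where A = "(\<lambda>(y,z). y \<otimes>\<^bsub>G\<^esub> z) ` (supp f \<times> supp h)"])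
  show "finite ((\<lambda>(y,z). y \<otimes>\<^bsub>G\<^esub> z) ` (supp f \<times> supp h))" using assms finite_supp by auto
  fix x assume x: "x \<in> carrier G"
  have eq: "(f \<otimes>\<^bsub>RG\<^esub> h) x = (\<Oplus>\<^bsub>R\<^esub>y\<in>supp f. f y \<otimes>\<^bsub>R\<^esub> h (inv\<^bsub>G\<^esub> y \<otimes>\<^bsub>G\<^esub> x))"
    using assms x finite_supp supp_in_carrier by (intro mult_coeff) auto
  show "(f \<otimes>\<^bsub>RG\<^esub> h) x \<in> carrier R" unfolding eq
    by (rule R.finsum_closed) (use assms x coeff_closed supp_in_carrier in auto)
  assume nx: "x \<notin> (\<lambda>(y,z). y \<otimes>\<^bsub>G\<^esub> z) ` (supp f \<times> supp h)"
  have z: "f y \<otimes>\<^bsub>R\<^esub> h (inv\<^bsub>G\<^esub> y \<otimes>\<^bsub>G\<^esub> x) = \<zero>\<^bsub>R\<^esub>" if y: "y \<in> supp f" for y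
  proof -
    have yc: "y \<in> carrier G" using y supp_in_carrier by auto
    have "x = y \<otimes>\<^bsub>G\<^esub> (inv\<^bsub>G\<^esub> y \<otimes>\<^bsub>G\<^esub> x)" using yc x by (simp add: G.m_assoc[symmetric])
    then have "inv\<^bsub>G\<^esub> y \<otimes>\<^bsub>G\<^esub> x \<notin> supp h" using nx y by force
    then have "h (inv\<^bsub>G\<^esub> y \<otimes>\<^bsub>G\<^esub> x) = \<zero>\<^bsub>R\<^esub>" using yc x by (auto simp: gr_supp_def)
    then show ?thesis using assms yc coeff_closed by auto
  qed
  show "(f \<otimes>\<^bsub>RG\<^esub> h) x = \<zero>\<^bsub>R\<^esub>" unfolding eq
    by (rule R.add.finprod_one_eqI[simplified]) (use z in auto)
qed (auto simp: group_ring_def)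

lemma mult_assoc:
  assumes f: "f \<in> carrier RG" and h: "h \<in> carrier RG" and k: "k \<in> carrier RG"
  shows "(f \<otimes>\<^bsub>RG\<^esub> h) \<otimes>\<^bsub>RG\<^esub> k = f \<otimes>\<^bsub>RG\<^esub> (h \<otimes>\<^bsub>RG\<^esub> k)"
proof (rule group_ring_eqI)
  fix x assume x: "x \<in> carrier G"
  define A where "A = supp f"
  define C where "C = supp h"
  define B where "B = (\<lambda>(y,z). y \<otimes>\<^bsub>G\<^esub> z) ` (A \<times> C) \<union> supp (f \<otimes>\<^bsub>RG\<^esub> h)"
  have fin: "finite A" "finite B" "finite C" using assms mult_in finite_supp by (auto simp: A_def B_def C_def)
  have sub: "A \<subseteq> carrier G" "B \<subseteq> carrier G" "C \<subseteq> carrier G"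
    using supp_in_carrier by (auto simp: A_def B_def C_def)
  have "((f \<otimes>\<^bsub>RG\<^esub> h) \<otimes>\<^bsub>RG\<^esub> k) x = (\<Oplus>\<^bsub>R\<^esub>z\<in>B. (f \<otimes>\<^bsub>RG\<^esub> h) z \<otimes>\<^bsub>R\<^esub> k (inv\<^bsub>G\<^esub> z \<otimes>\<^bsub>G\<^esub> x))"
    using assms mult_in x fin sub by (intro mult_coeff) (auto simp: B_def)
  also have "\<dots> = (\<Oplus>\<^bsub>R\<^esub>z\<in>B. \<Oplus>\<^bsub>R\<^esub>y\<in>A. f y \<otimes>\<^bsub>R\<^esub> (h (inv\<^bsub>G\<^esub> y \<otimes>\<^bsub>G\<^esub> z) \<otimes>\<^bsub>R\<^esub> k (inv\<^bsub>G\<^esub> z \<otimes>\<^bsub>G\<^esub> x)))"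
  proof (rule R.finsum_cong')
    fix z assume "z \<in> B"
    then have z: "z \<in> carrier G" using sub by auto
    have "(f \<otimes>\<^bsub>RG\<^esub> h) z = (\<Oplus>\<^bsub>R\<^esub>y\<in>A. f y \<otimes>\<^bsub>R\<^esub> h (inv\<^bsub>G\<^esub> y \<otimes>\<^bsub>G\<^esub> z))"
      using assms z fin sub by (intro mult_coeff) (auto simp: A_def)
    then have "(f \<otimes>\<^bsub>RG\<^esub> h) z \<otimes>\<^bsub>R\<^esub> k (inv\<^bsub>G\<^esub> z \<otimes>\<^bsub>G\<^esub> x)
      = (\<Oplus>\<^bsub>R\<^esub>y\<in>A. f y \<otimes>\<^bsub>R\<^esub> h (inv\<^bsub>G\<^esub> y \<otimes>\<^bsub>G\<^esub> z) \<otimes>\<^bsub>R\<^esub> k (inv\<^bsub>G\<^esub> z \<otimes>\<^bsub>G\<^esub> x))"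
      using assms z x fin sub coeff_closed by (subst R.finsum_ldistr[symmetric]) (auto simp: coeff_closed)
    also have "\<dots> = (\<Oplus>\<^bsub>R\<^esub>y\<in>A. f y \<otimes>\<^bsub>R\<^esub> (h (inv\<^bsub>G\<^esub> y \<otimes>\<^bsub>G\<^esub> z) \<otimes>\<^bsub>R\<^esub> k (inv\<^bsub>G\<^esub> z \<otimes>\<^bsub>G\<^esub> x)))"
      by (rule R.finsum_cong') (use assms z x fin sub coeff_closed in \<open>auto intro!: R.m_assoc\<close>)
    finally show "(f \<otimes>\<^bsub>RG\<^esub> h) z \<otimes>\<^bsub>R\<^esub> k (inv\<^bsub>G\<^esub> z \<otimes>\<^bsub>G\<^esub> x) =
      (\<Oplus>\<^bsub>R\<^esub>y\<in>A. f y \<otimes>\<^bsub>R\<^esub> (h (inv\<^bsub>G\<^esub> y \<otimes>\<^bsub>G\<^esub> z) \<otimes>\<^bsub>R\<^esub> k (inv\<^bsub>G\<^esub> z \<otimes>\<^bsub>G\<^esub> x)))" .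
  qed (use assms x fin sub coeff_closed in \<open>auto simp: coeff_closed subsetD intro!: R.finsum_closed\<close>)
  also have "\<dots> = (\<Oplus>\<^bsub>R\<^esub>y\<in>A. \<Oplus>\<^bsub>R\<^esub>z\<in>B. f y \<otimes>\<^bsub>R\<^esub> (h (inv\<^bsub>G\<^esub> y \<otimes>\<^bsub>G\<^esub> z) \<otimes>\<^bsub>R\<^esub> k (inv\<^bsub>G\<^esub> z \<otimes>\<^bsub>G\<^esub> x)))"
    by (rule R.finsum_swap) (use assms x fin sub coeff_closed in \<open>auto simp: coeff_closed subsetD\<close>)
  also have "\<dots> = (\<Oplus>\<^bsub>R\<^esub>y\<in>A. f y \<otimes>\<^bsub>R\<^esub> (h \<otimes>\<^bsub>RG\<^esub> k) (inv\<^bsub>G\<^esub> y \<otimes>\<^bsub>G\<^esub> x))"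
  proof (rule R.finsum_cong')
    fix y assume yA: "y \<in> A"
    then have y: "y \<in> carrier G" using sub by auto
    let ?t = "\<lambda>z. h (inv\<^bsub>G\<^esub> y \<otimes>\<^bsub>G\<^esub> z) \<otimes>\<^bsub>R\<^esub> k (inv\<^bsub>G\<^esub> z \<otimes>\<^bsub>G\<^esub> x)"
    have inj: "inj_on ((\<otimes>\<^bsub>G\<^esub>) y) C" using y sub by (meson G.inj_on_cmult inj_on_subset)
    have "(\<Oplus>\<^bsub>R\<^esub>z\<in>B. ?t z) = (\<Oplus>\<^bsub>R\<^esub>z\<in>(\<otimes>\<^bsub>G\<^esub>) y ` C. ?t z)"
    proof (rule R.add.finprod_mono_neutral_cong_right[OF fin(2)])
      show "(\<otimes>\<^bsub>G\<^esub>) y ` C \<subseteq> B" using yA by (auto simp: B_def)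
      fix i assume i: "i \<in> B - (\<otimes>\<^bsub>G\<^esub>) y ` C"
      then have ic: "i \<in> carrier G" using sub by auto
      have "i = y \<otimes>\<^bsub>G\<^esub> (inv\<^bsub>G\<^esub> y \<otimes>\<^bsub>G\<^esub> i)" using y ic by (simp add: G.m_assoc[symmetric])
      then have "inv\<^bsub>G\<^esub> y \<otimes>\<^bsub>G\<^esub> i \<notin> C" using i by blast
      then have "h (inv\<^bsub>G\<^esub> y \<otimes>\<^bsub>G\<^esub> i) = \<zero>\<^bsub>R\<^esub>" using y ic by (auto simp: gr_supp_def C_def)
      then show "?t i = \<zero>\<^bsub>R\<^esub>" using ic x k coeff_closed by auto
    qed (use assms x y fin sub in \<open>auto simp: coeff_closed subsetD\<close>)
    also have "\<dots> = (\<Oplus>\<^bsub>R\<^esub>w\<in>C. ?t (y \<otimes>\<^bsub>G\<^esub> w))"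
      by (rule R.finsum_reindex[OF _ inj]) (use assms x y fin sub in \<open>auto simp: coeff_closed subsetD\<close>)
    also have "\<dots> = (\<Oplus>\<^bsub>R\<^esub>w\<in>C. h w \<otimes>\<^bsub>R\<^esub> k (inv\<^bsub>G\<^esub> w \<otimes>\<^bsub>G\<^esub> (inv\<^bsub>G\<^esub> y \<otimes>\<^bsub>G\<^esub> x)))"
    proof (rule R.finsum_cong')
      fix w assume "w \<in> C"
      then have w: "w \<in> carrier G" using sub by auto
      show "?t (y \<otimes>\<^bsub>G\<^esub> w) = h w \<otimes>\<^bsub>R\<^esub> k (inv\<^bsub>G\<^esub> w \<otimes>\<^bsub>G\<^esub> (inv\<^bsub>G\<^esub> y \<otimes>\<^bsub>G\<^esub> x))"
        using w x y by (simp add: G.m_assoc[symmetric] G.inv_mult_group)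
    qed (use assms x y fin sub in \<open>auto simp: coeff_closed subsetD\<close>)
    also have "\<dots> = (h \<otimes>\<^bsub>RG\<^esub> k) (inv\<^bsub>G\<^esub> y \<otimes>\<^bsub>G\<^esub> x)"
      using assms x y fin sub by (intro mult_coeff[symmetric]) (auto simp: C_def)
    finally have e: "(\<Oplus>\<^bsub>R\<^esub>z\<in>B. ?t z) = (h \<otimes>\<^bsub>RG\<^esub> k) (inv\<^bsub>G\<^esub> y \<otimes>\<^bsub>G\<^esub> x)" .
    show "(\<Oplus>\<^bsub>R\<^esub>z\<in>B. f y \<otimes>\<^bsub>R\<^esub> ?t z) = f y \<otimes>\<^bsub>R\<^esub> (h \<otimes>\<^bsub>RG\<^esub> k) (inv\<^bsub>G\<^esub> y \<otimes>\<^bsub>G\<^esub> x)"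
      unfolding e[symmetric]
      by (rule R.finsum_rdistr[symmetric]) (use assms x y fin sub in \<open>auto simp: coeff_closed subsetD\<close>)
  qed (use assms x sub mult_in in \<open>auto simp: coeff_closed subsetD\<close>)
  also have "\<dots> = (f \<otimes>\<^bsub>RG\<^esub> (h \<otimes>\<^bsub>RG\<^esub> k)) x"
    using assms x fin sub mult_in by (intro mult_coeff[symmetric]) (auto simp: A_def)
  finally show "((f \<otimes>\<^bsub>RG\<^esub> h) \<otimes>\<^bsub>RG\<^esub> k) x = (f \<otimes>\<^bsub>RG\<^esub> (h \<otimes>\<^bsub>RG\<^esub> k)) x" .
qed (use assms mult_in in auto)

lemma one_in: "\<one>\<^bsub>RG\<^esub> \<in> carrier RG"
  by (rule group_ring_memI[of "{\<one>\<^bsub>G\<^esub>}"]) (auto simp: group_ring_def)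

lemma add_coeff: "x \<in> carrier G \<Longrightarrow> (f \<oplus>\<^bsub>RG\<^esub> h) x = f x \<oplus>\<^bsub>R\<^esub> h x"
  by (auto simp: group_ring_def)

lemma add_in: assumes "f \<in> carrier RG" "h \<in> carrier RG" shows "f \<oplus>\<^bsub>RG\<^esub> h \<in> carrier RG"
  by (rule group_ring_memI[of "supp f \<union> supp h"]) (use assms finite_supp coeff_closed in \<open>auto simp: add_coeff gr_supp_def\<close>, auto simp: group_ring_def)

lemma zero_in: "\<zero>\<^bsub>RG\<^esub> \<in> carrier RG"
  by (rule group_ring_memI[of "{}"]) (auto simp: group_ring_def)

lemma zero_coeff: "x \<in> carrier G \<Longrightarrow> \<zero>\<^bsub>RG\<^esub> x = \<zero>\<^bsub>R\<^esub>"
  by (auto simp: group_ring_def)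

lemma one_coeff: "x \<in> carrier G \<Longrightarrow> \<one>\<^bsub>RG\<^esub> x = (if x = \<one>\<^bsub>G\<^esub> then \<one>\<^bsub>R\<^esub> else \<zero>\<^bsub>R\<^esub>)"
  by (auto simp: group_ring_def)

lemma abelian_group_RG: "abelian_group RG"
proof (rule abelian_groupI)
  fix f assume f: "f \<in> carrier RG"
  let ?h = "\<lambda>x\<in>carrier G. \<ominus>\<^bsub>R\<^esub> f x"
  have c: "?h \<in> carrier RG"
    by (rule group_ring_memI[of "supp f"]) (use f finite_supp coeff_closed in \<open>auto simp: gr_supp_def\<close>)
  have "?h \<oplus>\<^bsub>RG\<^esub> f = \<zero>\<^bsub>RG\<^esub>"
    by (rule group_ring_eqI) (use c f in \<open>auto simp: add_coeff zero_coeff intro!: add_in zero_in R.l_neg coeff_closed\<close>)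
  then show "\<exists>h\<in>carrier RG. h \<oplus>\<^bsub>RG\<^esub> f = \<zero>\<^bsub>RG\<^esub>" using c by blast
next
  fix f assume "f \<in> carrier RG"
  then show "\<zero>\<^bsub>RG\<^esub> \<oplus>\<^bsub>RG\<^esub> f = f"
    by (intro group_ring_eqI) (auto simp: add_coeff zero_coeff coeff_closed intro!: add_in zero_in)
next
  fix f h assume "f \<in> carrier RG" "h \<in> carrier RG"
  then show "f \<oplus>\<^bsub>RG\<^esub> h = h \<oplus>\<^bsub>RG\<^esub> f"
    by (intro group_ring_eqI) (auto simp: add_coeff coeff_closed intro!: add_in R.a_comm)
next
  fix f h k assume "f \<in> carrier RG" "h \<in> carrier RG" "k \<in> carrier RG"
  then show "f \<oplus>\<^bsub>RG\<^esub> h \<oplus>\<^bsub>RG\<^esub> k = f \<oplus>\<^bsub>RG\<^esub> (h \<oplus>\<^bsub>RG\<^esub> k)"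
    by (intro group_ring_eqI) (auto simp: add_coeff coeff_closed intro!: add_in R.a_assoc)
qed (auto intro: add_in zero_in)

lemma one_mult: assumes f: "f \<in> carrier RG" shows "\<one>\<^bsub>RG\<^esub> \<otimes>\<^bsub>RG\<^esub> f = f"
proof (rule group_ring_eqI)
  fix x assume x: "x \<in> carrier G"
  have "(\<one>\<^bsub>RG\<^esub> \<otimes>\<^bsub>RG\<^esub> f) x = (\<Oplus>\<^bsub>R\<^esub>y\<in>{\<one>\<^bsub>G\<^esub>}. \<one>\<^bsub>RG\<^esub> y \<otimes>\<^bsub>R\<^esub> f (inv\<^bsub>G\<^esub> y \<otimes>\<^bsub>G\<^esub> x))"
    by (rule mult_coeff) (use f x one_in in \<open>auto simp: gr_supp_def one_coeff split: if_splits\<close>)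
  then show "(\<one>\<^bsub>RG\<^esub> \<otimes>\<^bsub>RG\<^esub> f) x = f x" using f x coeff_closed by (simp add: one_coeff)
qed (use assms mult_in one_in in auto)

lemma mult_one: assumes f: "f \<in> carrier RG" shows "f \<otimes>\<^bsub>RG\<^esub> \<one>\<^bsub>RG\<^esub> = f"
proof (rule group_ring_eqI)
  fix x assume x: "x \<in> carrier G"
  have e: "inv\<^bsub>G\<^esub> y \<otimes>\<^bsub>G\<^esub> x = \<one>\<^bsub>G\<^esub> \<longleftrightarrow> x = y" if "y \<in> carrier G" for y
    using x that by (metis G.inv_solve_left G.one_closed G.r_one)
  have "(f \<otimes>\<^bsub>RG\<^esub> \<one>\<^bsub>RG\<^esub>) x = (\<Oplus>\<^bsub>R\<^esub>y\<in>insert x (supp f). f y \<otimes>\<^bsub>R\<^esub> \<one>\<^bsub>RG\<^esub> (inv\<^bsub>G\<^esub> y \<otimes>\<^bsub>G\<^esub> x))"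
    by (rule mult_coeff) (use f x one_in finite_supp supp_in_carrier in auto)
  also have "\<dots> = (\<Oplus>\<^bsub>R\<^esub>y\<in>insert x (supp f). if x = y then f y else \<zero>\<^bsub>R\<^esub>)"
    by (rule R.finsum_cong') (use f x supp_in_carrier coeff_closed e one_coeff in auto)
  also have "\<dots> = f x"
    by (rule R.finsum_singleton) (use f x finite_supp supp_in_carrier coeff_closed in auto)
  finally show "(f \<otimes>\<^bsub>RG\<^esub> \<one>\<^bsub>RG\<^esub>) x = f x" .
qed (use assms mult_in one_in in auto)

lemma ring_RG: "ring RG"
proof (rule ringI)
  show "abelian_group RG" by (rule abelian_group_RG)
  show "monoid RG" by (rule monoidI) (auto intro: mult_in one_in mult_assoc one_mult mult_one)
next
  fix f h k assume a: "f \<in> carrier RG" "h \<in> carrier RG" "k \<in> carrier RG"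
  have fin: "finite (supp f \<union> supp h)" "supp f \<union> supp h \<subseteq> carrier G" using a finite_supp supp_in_carrier by auto
  have s: "supp (f \<oplus>\<^bsub>RG\<^esub> h) \<subseteq> supp f \<union> supp h" by (auto simp: gr_supp_def add_coeff)
  show "(f \<oplus>\<^bsub>RG\<^esub> h) \<otimes>\<^bsub>RG\<^esub> k = f \<otimes>\<^bsub>RG\<^esub> k \<oplus>\<^bsub>RG\<^esub> h \<otimes>\<^bsub>RG\<^esub> k"
  proof (rule group_ring_eqI)
    fix x assume x: "x \<in> carrier G"
    have 1: "(\<lambda>y. f y \<otimes>\<^bsub>R\<^esub> k (inv\<^bsub>G\<^esub> y \<otimes>\<^bsub>G\<^esub> x)) \<in> supp f \<union> supp h \<rightarrow> carrier R"
      "(\<lambda>y. h y \<otimes>\<^bsub>R\<^esub> k (inv\<^bsub>G\<^esub> y \<otimes>\<^bsub>G\<^esub> x)) \<in> supp f \<union> supp h \<rightarrow> carrier R"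
      using a x supp_in_carrier by (auto simp: coeff_closed)
    have "((f \<oplus>\<^bsub>RG\<^esub> h) \<otimes>\<^bsub>RG\<^esub> k) x = (\<Oplus>\<^bsub>R\<^esub>y\<in>supp f \<union> supp h. (f \<oplus>\<^bsub>RG\<^esub> h) y \<otimes>\<^bsub>R\<^esub> k (inv\<^bsub>G\<^esub> y \<otimes>\<^bsub>G\<^esub> x))"
      using a x fin s add_in by (intro mult_coeff) auto
    also have "\<dots> = (\<Oplus>\<^bsub>R\<^esub>y\<in>supp f \<union> supp h. f y \<otimes>\<^bsub>R\<^esub> k (inv\<^bsub>G\<^esub> y \<otimes>\<^bsub>G\<^esub> x) \<oplus>\<^bsub>R\<^esub> h y \<otimes>\<^bsub>R\<^esub> k (inv\<^bsub>G\<^esub> y \<otimes>\<^bsub>G\<^esub> x))"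
      by (rule R.finsum_cong') (use a x supp_in_carrier in \<open>auto simp: add_coeff coeff_closed R.l_distr\<close>)
    also have "\<dots> = (f \<otimes>\<^bsub>RG\<^esub> k) x \<oplus>\<^bsub>R\<^esub> (h \<otimes>\<^bsub>RG\<^esub> k) x"
      using R.finsum_addf[OF 1] a x fin by (simp add: mult_coeff[where A = "supp f \<union> supp h"])
    finally show "((f \<oplus>\<^bsub>RG\<^esub> h) \<otimes>\<^bsub>RG\<^esub> k) x = (f \<otimes>\<^bsub>RG\<^esub> k \<oplus>\<^bsub>RG\<^esub> h \<otimes>\<^bsub>RG\<^esub> k) x" using x by (simp add: add_coeff)
  qed (use a add_in mult_in in auto)
  show "k \<otimes>\<^bsub>RG\<^esub> (f \<oplus>\<^bsub>RG\<^esub> h) = k \<otimes>\<^bsub>RG\<^esub> f \<oplus>\<^bsub>RG\<^esub> k \<otimes>\<^bsub>RG\<^esub> h"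
  proof (rule group_ring_eqI)
    fix x assume x: "x \<in> carrier G"
    have 1: "(\<lambda>y. k y \<otimes>\<^bsub>R\<^esub> f (inv\<^bsub>G\<^esub> y \<otimes>\<^bsub>G\<^esub> x)) \<in> supp k \<rightarrow> carrier R"
      "(\<lambda>y. k y \<otimes>\<^bsub>R\<^esub> h (inv\<^bsub>G\<^esub> y \<otimes>\<^bsub>G\<^esub> x)) \<in> supp k \<rightarrow> carrier R"
      using a x by (auto simp: coeff_closed dest: supp_in_carrier)
    have fk: "finite (supp k)" "supp k \<subseteq> carrier G" using a finite_supp supp_in_carrier by auto
    have "(k \<otimes>\<^bsub>RG\<^esub> (f \<oplus>\<^bsub>RG\<^esub> h)) x = (\<Oplus>\<^bsub>R\<^esub>y\<in>supp k. k y \<otimes>\<^bsub>R\<^esub> (f \<oplus>\<^bsub>RG\<^esub> h) (inv\<^bsub>G\<^esub> y \<otimes>\<^bsub>G\<^esub> x))"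
      using a x fk add_in by (intro mult_coeff) auto
    also have "\<dots> = (\<Oplus>\<^bsub>R\<^esub>y\<in>supp k. k y \<otimes>\<^bsub>R\<^esub> f (inv\<^bsub>G\<^esub> y \<otimes>\<^bsub>G\<^esub> x) \<oplus>\<^bsub>R\<^esub> k y \<otimes>\<^bsub>R\<^esub> h (inv\<^bsub>G\<^esub> y \<otimes>\<^bsub>G\<^esub> x))"
      by (rule R.finsum_cong') (use a x supp_in_carrier in \<open>auto simp: add_coeff coeff_closed R.r_distr\<close>)
    also have "\<dots> = (k \<otimes>\<^bsub>RG\<^esub> f) x \<oplus>\<^bsub>R\<^esub> (k \<otimes>\<^bsub>RG\<^esub> h) x"
      using R.finsum_addf[OF 1] a x fk by (simp add: mult_coeff[where A = "supp k"])
    finally show "(k \<otimes>\<^bsub>RG\<^esub> (f \<oplus>\<^bsub>RG\<^esub> h)) x = (k \<otimes>\<^bsub>RG\<^esub> f \<oplus>\<^bsub>RG\<^esub> k \<otimes>\<^bsub>RG\<^esub> h) x" using x by (simp add: add_coeff)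
  qed (use a add_in mult_in in auto)
qed

end
lemma ring_group_ring: "ring R \<Longrightarrow> group G \<Longrightarrow> ring (group_ring R G)"
  by (rule group_ring_setup.ring_RG) (simp add: group_ring_setup_def)

end

theory Submission
  imports Defs
begin

text \<open>An element \<open>x\<close> is strongly nil-clean iff \<open>x (1 - x)\<close> is nilpotent, so strong unit
  nil-cleanness passes to homomorphic images and lifts along surjections with nil kernel.

  For part (1), the nilpotents \<open>N\<close> of \<open>R\<close> form a locally nilpotent ideal, hence \<open>NG\<close> is nil and
  one may replace \<open>R\<close> by the reduced ring \<open>S = R/N\<close>, in which every element is a unit multiple of
  a central idempotent. An element \<open>a\<close> of \<open>SG\<close> is supported on a finite subgroup \<open>H\<close>; put
  \<open>k = card H\<close>. Over a division ring, \<open>1, a, \<dots>, a^k\<close> are linearly dependent, which gives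
  \<open>a^k = a^(k+1) b = c a^(k+1)\<close>. A Zorn argument on the ideals of \<open>S\<close> reduces to that case. Such an
  \<open>a\<close> has a Fitting decomposition: \<open>a\<close> is a unit in a corner \<open>e\<close> commuting with it and nilpotent
  on \<open>1 - e\<close>, so inverting it on the corner produces the unit multiplier.

  For part (2), use the augmentation map, and for torsion the element \<open>1 - g\<close>.\<close>

section \<open>Strongly nil-clean elements\<close>

text \<open>The exponent \<open>card H\<close> depends on the support of the element only, not on
  the ideal of coefficients. The Zorn argument needs this uniformity: solutions of a^k = a^(k+1) b
  modulo two ideals are glued with the coefficients e and 1 - e, which requires the same power on
  both sides. Solvability involves only finitely many coefficients, so it descends from the union of
  a chain of ideals to one of its members.

  Division rings arise because idempotents of a reduced ring are central: each element is a unit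
  multiple of some idempotent e, and modulo a maximal bad ideal either e or 1 - e vanishes.

  Both equations, with b on the right and with c on the left, are carried along, since without
  commutativity the Fitting idempotent comes from identifying a right-hand projection with a
  left-hand one.

  That N is locally nilpotent, and not merely nil, makes NG nil: powers of an element of NG mix
  several coefficients, and long products of these must vanish.\<close>

lemma (in ring) geometric_factor:
  assumes x: "x \<in> carrier R"
  shows "\<exists>y\<in>carrier R. x \<otimes> y = y \<otimes> x \<and> (\<one> \<ominus> x) \<otimes> y = \<one> \<ominus> x [^] (n::nat)"
proof (induction n)
  case 0
  show ?case by (rule bexI[of _ "\<zero>"]) (use x in \<open>auto simp: minus_eq r_neg\<close>)
next
  case (Suc n)
  then obtain y where y: "y \<in> carrier R" "x \<otimes> y = y \<otimes> x" "(\<one> \<ominus> x) \<otimes> y = \<one> \<ominus> x [^] n" by blast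
  \<comment> \<open>Here y is the geometric sum 1 + x + ... + x^(n-1); the next one is 1 + x
    y.\<close>
  have "(\<one> \<ominus> x) \<otimes> (\<one> \<oplus> x \<otimes> y) = (\<one> \<ominus> x) \<oplus> x \<otimes> ((\<one> \<ominus> x) \<otimes> y)"
    using x y(1) by (simp add: minus_eq l_distr r_distr l_minus r_minus m_assoc a_ac)
  also have "\<dots> = \<one> \<ominus> x \<otimes> x [^] n"
    using x y(1) unfolding y(3) by (simp add: minus_eq r_distr r_minus a_assoc r_neg1)
  also have "\<dots> = \<one> \<ominus> x [^] Suc n" using x by (simp add: nat_pow_comm[of x 1 n, simplified])
  finally have "(\<one> \<ominus> x) \<otimes> (\<one> \<oplus> x \<otimes> y) = \<one> \<ominus> x [^] Suc n" .
  moreover have "x \<otimes> (\<one> \<oplus> x \<otimes> y) = (\<one> \<oplus> x \<otimes> y) \<otimes> x"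
    using x y(1) y(2)[symmetric] by (simp add: l_distr r_distr m_assoc)
  ultimately show ?case using x y(1) by (intro bexI[of _ "\<one> \<oplus> x \<otimes> y"]) auto
qed

lemma (in ring) minus_pow_zero:
  assumes x: "x \<in> carrier R" and "x [^] (n::nat) = \<zero>"
  shows "(\<ominus> x) [^] n = \<zero>"
proof -
  have "(\<ominus> x) [^] m = x [^] m \<or> (\<ominus> x) [^] m = \<ominus> (x [^] m)" for m :: nat
    using x by (induction m) (auto simp: l_minus r_minus)
  then show ?thesis using assms(2) by (metis minus_zero)
qed

lemma (in ring) one_plus_nilpotent_Units:
  assumes "nilpotent R b"
  shows "\<one> \<oplus> b \<in> Units R"
proof -
  obtain n :: nat where b: "b \<in> carrier R" and n: "b [^] n = \<zero>"
    using assms by (auto simp: nilpotent_def)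
  obtain y where y: "y \<in> carrier R" "\<ominus> b \<otimes> y = y \<otimes> \<ominus> b"
      "(\<one> \<ominus> (\<ominus> b)) \<otimes> y = \<one> \<ominus> (\<ominus> b) [^] n"
    using geometric_factor[of "\<ominus> b" n] b by auto
  have 1: "(\<one> \<oplus> b) \<otimes> y = \<one>"
    using y(3) b minus_pow_zero[OF b n] by (simp add: minus_eq)
  have "b \<otimes> y = y \<otimes> b" using y(1,2) b by (simp add: l_minus r_minus) (metis minus_minus m_closed)
  then have "y \<otimes> (\<one> \<oplus> b) = \<one>" using 1 b y(1) by (simp add: l_distr r_distr)
  then show ?thesis using 1 b y(1) by (auto simp: Units_def)
qed

text \<open>Needed to lift units along a homomorphism: lifts of a unit and of its inverse multiply
  to units, in general not to one. One product supplies a right inverse of u, the other a left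
  inverse.\<close>

lemma (in monoid) Units_if_mult_Units:
  assumes "u \<in> carrier G" "v \<in> carrier G" "u \<otimes> v \<in> Units G" "v \<otimes> u \<in> Units G"
  shows "u \<in> Units G"
proof -
  let ?r = "v \<otimes> inv (u \<otimes> v)" and ?l = "inv (v \<otimes> u) \<otimes> v"
  have c: "?r \<in> carrier G" "?l \<in> carrier G" using assms by auto
  have r: "u \<otimes> ?r = \<one>" using assms by (simp add: m_assoc[symmetric])
  have l: "?l \<otimes> u = \<one>" using assms by (simp add: m_assoc)
  have "?l = ?r" using inv_unique[OF l r] assms c by auto
  then show ?thesis using c r l assms(1) unfolding Units_def by auto
qed

text \<open>Idempotent lifting. With w = x^n, put e = 1 - (1 - w)^n. By geometric sums e is a
  multiple of x^n and 1 - e a multiple of (1 - x)^n, so e (1 - e) is a multiple of (x (1 - x))^n =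
  0. The difference b = x - e is a multiple of x and also of 1 - x, so b^2 is a multiple of the
  nilpotent x (1 - x).\<close>

lemma (in cring) strongly_nil_clean_if_nilpotent_defect_comm:
  assumes x: "x \<in> carrier R" and nil: "nilpotent R (x \<otimes> (\<one> \<ominus> x))"
  shows "strongly_nil_clean R x"
proof -
  obtain n :: nat where n: "n > 0" "(x \<otimes> (\<one> \<ominus> x)) [^] n = \<zero>"
    using nil by (auto simp: nilpotent_def)
  obtain m where m: "n = Suc m" using n(1) by (cases n) auto
  define w where "w = x [^] n"
  have w: "w \<in> carrier R" using x by (simp add: w_def)
  obtain q where q: "q \<in> carrier R" "(\<one> \<ominus> x) \<otimes> q = \<one> \<ominus> w"
    using geometric_factor[OF x, of n] by (auto simp: w_def)
  have ww: "\<one> \<ominus> (\<one> \<ominus> w) = w" using w by algebra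
  have cw: "\<one> \<ominus> w \<in> carrier R" using w by simp
  obtain p where p: "p \<in> carrier R" "w \<otimes> p = \<one> \<ominus> (\<one> \<ominus> w) [^] n"
    using geometric_factor[OF cw, of n] ww by auto
  define e where "e = w \<otimes> p"
  define f where "f = (\<one> \<ominus> x) [^] n \<otimes> q [^] n"
  have c: "e \<in> carrier R" "f \<in> carrier R" "x [^] m \<in> carrier R" "(\<one> \<ominus> x) [^] m \<in> carrier R"
    "q [^] n \<in> carrier R" "(\<one> \<ominus> w) [^] n \<in> carrier R" using x w p(1) q(1) by (auto simp: e_def f_def)
  have f: "f = (\<one> \<ominus> w) [^] n"
    using q x by (simp add: f_def nat_pow_distrib[symmetric])
  have ef: "f = \<one> \<ominus> e" unfolding e_def p(2) f using c(6) by algebra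
  have z: "x [^] n \<otimes> (\<one> \<ominus> x) [^] n = \<zero>" using n(2) x by (simp add: nat_pow_distrib)
  have "e \<otimes> f = (x [^] n \<otimes> (\<one> \<ominus> x) [^] n) \<otimes> (p \<otimes> q [^] n)"
    unfolding e_def f_def w_def using x p(1) q(1) by (simp add: m_ac)
  then have ef0: "e \<otimes> f = \<zero>" using z p(1) q(1) by simp
  have idem: "e \<otimes> e = e"
  proof -
    have "e \<otimes> e = e \<ominus> e \<otimes> (\<one> \<ominus> e)" using c(1) by algebra
    then show ?thesis using ef0 c(1) unfolding ef by (simp add: minus_eq)
  qed
  define b where "b = x \<ominus> e"
  have cb: "b \<in> carrier R" using x c by (simp add: b_def)
  have b1: "b = x \<otimes> (\<one> \<ominus> x [^] m \<otimes> p)"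
    unfolding b_def e_def w_def m nat_pow_Suc using x p(1) c(3) by algebra
  \<comment> \<open>Write x - e as (1 - e) - (1 - x); both terms are multiples of 1 - x.\<close>
  have b2: "b = (\<one> \<ominus> x) \<otimes> ((\<one> \<ominus> x) [^] m \<otimes> q [^] n \<ominus> \<one>)"
  proof -
    have "b = f \<ominus> (\<one> \<ominus> x)" unfolding b_def ef using x c by algebra
    also have "\<dots> = (\<one> \<ominus> x) \<otimes> ((\<one> \<ominus> x) [^] m \<otimes> q [^] n \<ominus> \<one>)"
      unfolding f_def nat_pow_Suc[of "\<one> \<ominus> x" m, folded m] using x c(4,5) by algebra
    finally show ?thesis .
  qed
  let ?s = "\<one> \<ominus> x [^] m \<otimes> p" and ?t = "(\<one> \<ominus> x) [^] m \<otimes> q [^] n \<ominus> \<one>"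
  have st: "?s \<in> carrier R" "?t \<in> carrier R" using x c p(1) by auto
  have "b \<otimes> b = (x \<otimes> ?s) \<otimes> ((\<one> \<ominus> x) \<otimes> ?t)" using b1 b2 by metis
  also have "\<dots> = (x \<otimes> (\<one> \<ominus> x)) \<otimes> (?s \<otimes> ?t)"
    using x st by (simp add: m_ac)
  finally have "(b \<otimes> b) [^] n = \<zero>" using n(2) x st by (simp add: nat_pow_distrib)
  then have "b [^] (2 * n) = \<zero>"
    using nat_pow_pow[OF cb, of 2 n] cb by (simp add: numeral_2_eq_2)
  then have "nilpotent R b" using cb n(1) unfolding nilpotent_def by (intro conjI exI[of _ "2 * n"]) auto
  moreover have "x = e \<oplus> b" unfolding b_def using x c by algebra
  ultimately show ?thesis
    unfolding strongly_nil_clean_def using c(1) cb idem m_comm[of e b] by blast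
qed

text \<open>The double centralizer of \<open>x\<close> is a commutative subring containing \<open>x\<close>, so the
  commutative case applies there.\<close>

lemma (in ring) strongly_nil_clean_if_nilpotent_defect:
  assumes x: "x \<in> carrier R" and nil: "nilpotent R (x \<otimes> (\<one> \<ominus> x))"
  shows "strongly_nil_clean R x"
proof -
  define Z where "Z = {z \<in> carrier R. z \<otimes> x = x \<otimes> z}"
  define C where "C = {y \<in> carrier R. \<forall>z\<in>Z. y \<otimes> z = z \<otimes> y}"
  let ?K = "R\<lparr>carrier := C\<rparr>"
  have xZ: "x \<in> Z" using x by (simp add: Z_def)
  \<comment> \<open>This inclusion makes C commutative: its elements commute with all of Z, in
    particular with each other. The centralizer Z alone need not be commutative.\<close>
  have CZ: "C \<subseteq> Z" using xZ by (auto simp: C_def Z_def)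
  have Zc: "z \<in> carrier R" if "z \<in> Z" for z using that by (simp add: Z_def)
  have sub: "subring C R"
  proof (rule subringI)
    show "C \<subseteq> carrier R" "\<one> \<in> C" using Zc by (auto simp: C_def)
    show "\<ominus> h \<in> C" if "h \<in> C" for h using that Zc by (auto simp: C_def l_minus r_minus)
    show "h1 \<oplus> h2 \<in> C" if "h1 \<in> C" "h2 \<in> C" for h1 h2
      using that Zc by (auto simp: C_def l_distr r_distr)
    show "h1 \<otimes> h2 \<in> C" if h: "h1 \<in> C" "h2 \<in> C" for h1 h2
    proof -
      have "(h1 \<otimes> h2) \<otimes> z = z \<otimes> (h1 \<otimes> h2)" if z: "z \<in> Z" for z
      proof -
        have c: "h1 \<in> carrier R" "h2 \<in> carrier R" "z \<in> carrier R"
          "h1 \<otimes> z = z \<otimes> h1" "h2 \<otimes> z = z \<otimes> h2" using h z Zc by (auto simp: C_def)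
        have "(h1 \<otimes> h2) \<otimes> z = h1 \<otimes> (z \<otimes> h2)" using c by (simp add: m_assoc)
        also have "\<dots> = (z \<otimes> h1) \<otimes> h2" using c(1-3) by (simp add: m_assoc[symmetric] c(4))
        finally show ?thesis using c by (simp add: m_assoc)
      qed
      then show ?thesis using h by (auto simp: C_def)
    qed
  qed
  have comm: "y \<otimes> y' = y' \<otimes> y" if "y \<in> C" "y' \<in> C" for y y'
    using that CZ by (auto simp: C_def)
  have scr: "subcring C R" by (rule subcringI[OF sub]) (use comm in auto)
  have CR: "C \<subseteq> carrier R" by (auto simp: C_def)
  interpret K: cring ?K using subcring_iff[OF CR] scr by simp
  have xC: "x \<in> C" using x by (auto simp: C_def Z_def)
  \<comment> \<open>The additive inverse is defined relative to the carrier, so restricting the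
    carrier calls for a proof that it is unchanged.\<close>
  have m: "a_minus ?K \<one> x = \<one> \<ominus> x"
  proof -
    have "\<ominus>\<^bsub>?K\<^esub> x = \<ominus> x"
    proof (rule K.minus_equality[simplified])
      show "\<ominus> x \<oplus> x = \<zero>" using x by (rule l_neg)
    qed (use xC subringE(5)[OF sub] in auto)
    then show ?thesis by (simp add: a_minus_def)
  qed
  have pow: "y [^]\<^bsub>?K\<^esub> n = y [^] n" for y and n :: nat
    by (induction n) simp_all
  have dC: "x \<otimes> (\<one> \<ominus> x) \<in> C"
    using K.m_closed[of x "a_minus ?K \<one> x"] xC m subringE(3)[OF sub] K.minus_closed[of \<one> x] by simp
  have "nilpotent ?K (x \<otimes> (\<one> \<ominus> x))"
    using nil dC by (simp add: nilpotent_def pow)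
  then have "strongly_nil_clean ?K x"
    using K.strongly_nil_clean_if_nilpotent_defect_comm[of x] xC m by simp
  then obtain e b where eb: "e \<in> C" "b \<in> C" "e \<otimes> e = e" "nilpotent ?K b" "e \<otimes> b = b \<otimes> e" "x = e \<oplus> b"
    unfolding strongly_nil_clean_def by auto
  have "nilpotent R b" using eb(4) CR unfolding nilpotent_def pow by auto
  then show ?thesis using eb CR unfolding strongly_nil_clean_def by blast
qed

section \<open>Transfer along ring homomorphisms\<close>

lemma (in ring_hom_ring) hom_Units:
  assumes "u \<in> Units R" shows "h u \<in> Units S"
proof -
  obtain v where v: "v \<in> carrier R" "u \<otimes> v = \<one>" "v \<otimes> u = \<one>" and u: "u \<in> carrier R"
    using assms by (auto simp: Units_def)
  have "h u \<otimes>\<^bsub>S\<^esub> h v = \<one>\<^bsub>S\<^esub>" "h v \<otimes>\<^bsub>S\<^esub> h u = \<one>\<^bsub>S\<^esub>"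
    using u v by (metis hom_mult hom_one)+
  then show ?thesis using u v(1) by (auto simp: Units_def)
qed

lemma (in ring_hom_ring) hom_nilpotent: "nilpotent R b \<Longrightarrow> nilpotent S (h b)"
  unfolding nilpotent_def by (metis hom_closed hom_nat_pow hom_zero)

lemma (in ring_hom_ring) hom_strongly_nil_clean:
  assumes "strongly_nil_clean R a" shows "strongly_nil_clean S (h a)"
proof -
  obtain e b where *: "e \<in> carrier R" "b \<in> carrier R" "e \<otimes> e = e" "nilpotent R b"
    "e \<otimes> b = b \<otimes> e" "a = e \<oplus> b" using assms by (auto simp: strongly_nil_clean_def)
  have "h e \<otimes>\<^bsub>S\<^esub> h e = h e" "h e \<otimes>\<^bsub>S\<^esub> h b = h b \<otimes>\<^bsub>S\<^esub> h e" "h a = h e \<oplus>\<^bsub>S\<^esub> h b"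
    using *(1,2) by (simp_all add: *(3,5,6) flip: hom_mult)
  then show ?thesis using *(1,2) hom_nilpotent[OF *(4)] unfolding strongly_nil_clean_def by auto
qed

lemma (in ring_hom_ring) surj_strongly_unit_nil_clean:
  assumes "h ` carrier R = carrier S" "strongly_unit_nil_clean R"
  shows "strongly_unit_nil_clean S"
  unfolding strongly_unit_nil_clean_def
proof
  fix a assume "a \<in> carrier S"
  then obtain a' where a': "a' \<in> carrier R" "a = h a'" using assms(1) by auto
  then obtain u where u: "u \<in> Units R" "strongly_nil_clean R (u \<otimes> a')"
    using assms(2) by (auto simp: strongly_unit_nil_clean_def)
  have "strongly_nil_clean S (h u \<otimes>\<^bsub>S\<^esub> a)"
    using hom_strongly_nil_clean[OF u(2)] u(1) a' by (simp add: R.Units_closed)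
  then show "\<exists>u\<in>Units S. strongly_nil_clean S (u \<otimes>\<^bsub>S\<^esub> a)" using hom_Units[OF u(1)] by blast
qed

lemma (in ring) nilpotent_if_pow_nilpotent:
  assumes y: "y \<in> carrier R" and n: "(n::nat) > 0" and "nilpotent R (y [^] n)"
  shows "nilpotent R y"
proof -
  obtain m :: nat where m: "m > 0" "(y [^] n) [^] m = \<zero>"
    using assms(3) unfolding nilpotent_def by blast
  then have "y [^] (n * m) = \<zero>" "n * m > 0" using n nat_pow_pow[OF y] by auto
  then show ?thesis using y unfolding nilpotent_def by blast
qed

lemma (in ring) nilpotent_mult_comm:
  assumes b: "nilpotent R b" and c: "c \<in> carrier R" "b \<otimes> c = c \<otimes> b"
  shows "nilpotent R (b \<otimes> c)"
proof -
  obtain n :: nat where n: "b \<in> carrier R" "n > 0" "b [^] n = \<zero>" using b by (auto simp: nilpotent_def)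
  have "(b \<otimes> c) [^] n = b [^] n \<otimes> c [^] n"
    using pow_mult_distrib[OF c(2)] n c by simp
  then show ?thesis using n c unfolding nilpotent_def by auto
qed

text \<open>For a = e + b the idempotent part cancels and a (1 - a) = b (1 - 2 e - b), a nilpotent
  times an element commuting with it. This is the converse of the lifting criterion.\<close>

lemma (in ring) strongly_nil_clean_defect:
  assumes "strongly_nil_clean R a" shows "nilpotent R (a \<otimes> (\<one> \<ominus> a))"
proof -
  obtain e b where *: "e \<in> carrier R" "b \<in> carrier R" "e \<otimes> e = e" "nilpotent R b"
    "e \<otimes> b = b \<otimes> e" "a = e \<oplus> b" using assms by (auto simp: strongly_nil_clean_def)
  let ?c = "\<one> \<ominus> e \<ominus> a"
  have c: "?c \<in> carrier R" using * by simp
  have bc: "b \<otimes> ?c = ?c \<otimes> b" unfolding *(6) using *(1,2,5)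
    by (simp add: minus_eq l_distr r_distr l_minus r_minus minus_add)
  have "a \<otimes> (\<one> \<ominus> a) = (e \<oplus> b) \<ominus> (e \<oplus> b) \<otimes> e \<ominus> (e \<oplus> b) \<otimes> b" unfolding *(6) using *(1,2)
    by (simp add: minus_eq r_distr r_minus minus_add a_assoc)
  also have "\<dots> = e \<oplus> b \<oplus> \<ominus> e \<oplus> \<ominus> (b \<otimes> e) \<oplus> \<ominus> (b \<otimes> e) \<oplus> \<ominus> (b \<otimes> b)"
    using *(1,2,3,5) by (simp add: minus_eq l_distr minus_add a_assoc)
  also have "\<dots> = b \<otimes> ?c"
    unfolding *(6) using *(1,2) by (simp add: minus_eq r_distr r_minus minus_add a_ac r_neg2 r_neg1)
  finally show ?thesis using nilpotent_mult_comm[OF *(4) c bc] by simp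
qed

text \<open>No idempotent is lifted by hand. A preimage of one is one plus a nilpotent, so units
  lift. Some power of the defect x (1 - x) of the lifted multiple lies in the nil kernel, so the
  defect is nilpotent and the criterion yields a decomposition upstairs.\<close>

lemma (in ring_hom_ring) strongly_nil_clean_multiple_lift:
  assumes surj: "h ` carrier R = carrier S"
    and nil: "\<And>x. x \<in> carrier R \<Longrightarrow> h x = \<zero>\<^bsub>S\<^esub> \<Longrightarrow> nilpotent R x"
    and a: "a \<in> carrier R" and u: "u \<in> Units S" "strongly_nil_clean S (u \<otimes>\<^bsub>S\<^esub> h a)"
  shows "\<exists>u\<in>Units R. strongly_nil_clean R (u \<otimes> a)"
proof -
  have unit: "w \<in> Units R" if w: "w \<in> carrier R" "h w = \<one>\<^bsub>S\<^esub>" for w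
  proof -
    have "h (w \<ominus> \<one>) = \<zero>\<^bsub>S\<^esub>" using w by (simp add: R.minus_eq S.r_neg)
    then have "\<one> \<oplus> (w \<ominus> \<one>) \<in> Units R" using nil w by (intro R.one_plus_nilpotent_Units) auto
    moreover have "\<one> \<oplus> (w \<ominus> \<one>) = w" using w(1) by (simp add: R.minus_eq R.a_ac R.r_neg2 R.r_neg)
    ultimately show ?thesis by simp
  qed
  obtain v where v: "v \<in> carrier S" "u \<otimes>\<^bsub>S\<^esub> v = \<one>\<^bsub>S\<^esub>" "v \<otimes>\<^bsub>S\<^esub> u = \<one>\<^bsub>S\<^esub>"
    and uc: "u \<in> carrier S" using u(1) by (auto simp: Units_def)
  obtain u' v' where uv: "u' \<in> carrier R" "v' \<in> carrier R" "u = h u'" "v = h v'"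
    using uc v(1) surj by blast
  have U: "u' \<in> Units R" using uv v unit by (intro R.Units_if_mult_Units[of u' v']) auto
  let ?x = "u' \<otimes> a"
  have xc: "?x \<in> carrier R" using uv a by simp
  have "nilpotent S (h ?x \<otimes>\<^bsub>S\<^esub> (\<one>\<^bsub>S\<^esub> \<ominus>\<^bsub>S\<^esub> h ?x))"
    using S.strongly_nil_clean_defect[OF u(2)] uv a by simp
  moreover have "h (?x \<otimes> (\<one> \<ominus> ?x)) = h ?x \<otimes>\<^bsub>S\<^esub> (\<one>\<^bsub>S\<^esub> \<ominus>\<^bsub>S\<^esub> h ?x)"
  proof -
    have "h (y \<otimes> (\<one> \<ominus> y)) = h y \<otimes>\<^bsub>S\<^esub> (\<one>\<^bsub>S\<^esub> \<ominus>\<^bsub>S\<^esub> h y)" if "y \<in> carrier R" for y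
      using that by (simp add: R.minus_eq S.minus_eq)
    then show ?thesis using xc by blast
  qed
  ultimately obtain n :: nat where n: "n > 0" "h (?x \<otimes> (\<one> \<ominus> ?x)) [^]\<^bsub>S\<^esub> n = \<zero>\<^bsub>S\<^esub>"
    by (auto simp: nilpotent_def)
  let ?d = "?x \<otimes> (\<one> \<ominus> ?x)"
  have dc: "?d \<in> carrier R" using xc by simp
  have "nilpotent R (?d [^] n)"
    using n(2) dc by (intro nil) (simp_all only: hom_nat_pow R.nat_pow_closed)
  then have "nilpotent R ?d" by (rule R.nilpotent_if_pow_nilpotent[OF dc n(1)])
  then show ?thesis using R.strongly_nil_clean_if_nilpotent_defect[OF xc] U by blast
qed

text \<open>Substitute the equation into itself: multiply it by a^j on the left and b^j on the
  right. No commutation of a with b is involved. The case j = k turns the equation for a into one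
  for p = a^k, namely p = p^2 b^k.\<close>

lemma (in ring) pow_iterate:
  assumes "a \<in> carrier R" "b \<in> carrier R" "a [^] k = a [^] Suc k \<otimes> b"
  shows "a [^] (k::nat) = a [^] (k + j) \<otimes> b [^] (j::nat)"
proof (induction j)
  case (Suc j)
  have "a [^] (k + Suc j) \<otimes> b [^] Suc j = a [^] (j + Suc k) \<otimes> (b [^] (1 + j))" by (simp add: add.commute)
  also have "\<dots> = (a [^] j \<otimes> a [^] Suc k) \<otimes> (b \<otimes> b [^] j)"
    using assms(1,2) nat_pow_mult[OF assms(1), of j "Suc k"] nat_pow_mult[OF assms(2), of 1 j]
    by (simp del: nat_pow_Suc)
  also have "\<dots> = a [^] j \<otimes> (a [^] Suc k \<otimes> b) \<otimes> b [^] j"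
    using assms(1,2) by (simp add: m_assoc del: nat_pow_Suc)
  also have "\<dots> = a [^] (k + j) \<otimes> b [^] j"
    unfolding assms(3)[symmetric] using assms(1,2) by (simp add: nat_pow_mult add.commute)
  finally show ?case using Suc.IH by (simp only:)
qed (use assms(1) in simp)

section \<open>Strongly pi-regular elements\<close>

text \<open>Serves to obtain left-handed versions of \<open>pow_iterate\<close>, of linear
  dependence and of power absorption from the right-handed ones.\<close>

definition opposite_ring :: "('a, 'm) ring_scheme \<Rightarrow> ('a, 'm) ring_scheme" where
  "opposite_ring R = R\<lparr>monoid.mult := \<lambda>x y. y \<otimes>\<^bsub>R\<^esub> x\<rparr>"

lemma opposite_ring_simps [simp]:
  "carrier (opposite_ring R) = carrier R"
  "x \<otimes>\<^bsub>opposite_ring R\<^esub> y = y \<otimes>\<^bsub>R\<^esub> x"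
  "\<one>\<^bsub>opposite_ring R\<^esub> = \<one>\<^bsub>R\<^esub>"
  "\<zero>\<^bsub>opposite_ring R\<^esub> = \<zero>\<^bsub>R\<^esub>"
  "x \<oplus>\<^bsub>opposite_ring R\<^esub> y = x \<oplus>\<^bsub>R\<^esub> y"
  "Units (opposite_ring R) = Units R"
  by (auto simp: opposite_ring_def Units_def)

lemma (in ring) ring_opposite_ring: "ring (opposite_ring R)"
proof (rule ringI)
  show "abelian_group (opposite_ring R)"
    by (rule abelian_groupI) (auto simp: a_ac intro: bexI[of _ "\<ominus> _"] l_neg)
  show "Group.monoid (opposite_ring R)" by (rule monoidI) (auto simp: m_assoc)
qed (auto simp: l_distr r_distr)

lemma (in ring) opposite_ring_pow [simp]:
  "x \<in> carrier R \<Longrightarrow> x [^]\<^bsub>opposite_ring R\<^esub> (n::nat) = x [^] n"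
  by (induction n) (simp_all add: nat_pow_Suc2[symmetric])

text \<open>Fitting decomposition. For p = a^k one has p = p^2 y = z p^2, and e = p y = z p is an
  idempotent commuting with a. In the corner of e the element a has an inverse v, while f a is
  nilpotent for f = 1 - e because f p = 0. The unit is v + f, with inverse a e + f, and (v + f) a =
  e + f a.\<close>

lemma (in ring) strongly_nil_clean_multiple_if_strongly_pi_regular:
  assumes a: "a \<in> carrier R" and b: "b \<in> carrier R" and c: "c \<in> carrier R" and k: "(k::nat) > 0"
    and ab: "a [^] k = a [^] Suc k \<otimes> b" and ca: "a [^] k = c \<otimes> a [^] Suc k"
  shows "\<exists>u\<in>Units R. strongly_nil_clean R (u \<otimes> a)"
proof -
  interpret op: ring "opposite_ring R" by (rule ring_opposite_ring)
  define p where "p = a [^] k"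
  define y where "y = b [^] k"
  define z where "z = c [^] k"
  have pc: "p \<in> carrier R" and yc: "y \<in> carrier R" and zc: "z \<in> carrier R"
    using a b c by (auto simp: p_def y_def z_def)
  have py: "p \<otimes> (p \<otimes> y) = p"
    using pow_iterate[OF a b ab, of k] a b
    by (simp add: p_def y_def nat_pow_mult[symmetric] m_assoc)
  have "a [^] k = c [^] k \<otimes> a [^] (k + k)"
    using op.pow_iterate[of a c k k, unfolded opposite_ring_simps opposite_ring_pow[OF a]
        opposite_ring_pow[OF c], OF a c ca] .
  then have zp: "z \<otimes> (p \<otimes> p) = p"
    unfolding p_def z_def nat_pow_mult[OF a] by (rule sym)
  define e where "e = p \<otimes> y"
  have ec: "e \<in> carrier R" using pc yc by (simp add: e_def)
  \<comment> \<open>Both sides equal z p p y.\<close>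
  have e': "e = z \<otimes> p"
  proof -
    have "p \<otimes> y = z \<otimes> (p \<otimes> p) \<otimes> y" by (simp only: zp)
    also have "\<dots> = z \<otimes> (p \<otimes> (p \<otimes> y))" using pc yc zc by (simp add: m_assoc)
    finally show ?thesis by (simp only: py e_def)
  qed
  have pe: "p \<otimes> e = p" using py by (simp add: e_def)
  have ep: "e \<otimes> p = p" unfolding e' using zp pc zc by (simp add: m_assoc)
  have ee: "e \<otimes> e = e"
  proof -
    have "e \<otimes> e = z \<otimes> (p \<otimes> e)" using pc zc ec by (subst (1) e') (simp add: m_assoc)
    then show ?thesis by (simp only: pe e'[symmetric])
  qed
  have ap: "a \<otimes> p = p \<otimes> a" using nat_pow_Suc2[OF a, of k] by (simp add: p_def)
  \<comment> \<open>With e = z p, the factor p moves past a and is absorbed by p e = p. The mirror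
    argument with e = p y gives \<open>eae2\<close>, and both together make a commute with
    e.\<close>
  have eae1: "e \<otimes> (a \<otimes> e) = e \<otimes> a"
  proof -
    have "e \<otimes> (a \<otimes> e) = z \<otimes> (p \<otimes> a) \<otimes> e" using pc zc ec a by (subst (1) e') (simp add: m_assoc)
    also have "\<dots> = z \<otimes> a \<otimes> (p \<otimes> e)" using pc zc ec a ap[symmetric] by (simp add: m_assoc)
    also have "\<dots> = z \<otimes> (p \<otimes> a)" using pc zc a ap[symmetric] by (simp add: m_assoc pe)
    finally show ?thesis using pc zc a by (simp add: e' m_assoc)
  qed
  have eae2: "e \<otimes> (a \<otimes> e) = a \<otimes> e"
  proof -
    have "e \<otimes> (a \<otimes> e) = e \<otimes> (a \<otimes> p \<otimes> y)" using pc yc ec a by (subst (2) e_def) (simp add: m_assoc)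
    also have "\<dots> = (e \<otimes> p) \<otimes> a \<otimes> y" using pc yc ec a unfolding ap by (simp add: m_assoc)
    also have "\<dots> = a \<otimes> (p \<otimes> y)" unfolding ep ap[symmetric] using pc yc a by (simp add: m_assoc)
    finally show ?thesis by (simp only: e_def)
  qed
  have ae: "a \<otimes> e = e \<otimes> a" using eae1 eae2 by simp
  \<comment> \<open>The compression of y to the corner of e, where it is a two-sided inverse of
    p.\<close>
  define q where "q = e \<otimes> y \<otimes> e"
  have qc: "q \<in> carrier R" using ec yc by (simp add: q_def)
  have pq: "p \<otimes> q = e"
  proof -
    have "p \<otimes> q = (p \<otimes> e) \<otimes> y \<otimes> e" using pc ec yc by (simp add: q_def m_assoc)
    then show ?thesis unfolding pe by (simp only: e_def[symmetric] ee)
  qed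
  have qe: "q \<otimes> e = q" using ec yc ee by (simp add: q_def m_assoc)
  have eq: "e \<otimes> q = q" using ec yc ee by (simp add: q_def m_assoc[symmetric])
  have qp: "q \<otimes> p = e"
  proof -
    \<comment> \<open>In the corner, e z e is a left inverse of p and q is a right inverse, so they
      agree.\<close>
    have zq: "e \<otimes> z \<otimes> e = q"
    proof -
      have "e \<otimes> z \<otimes> e = e \<otimes> z \<otimes> (p \<otimes> q)" by (simp only: pq)
      also have "\<dots> = e \<otimes> (z \<otimes> p) \<otimes> q" using ec zc pc qc by (simp add: m_assoc)
      finally show ?thesis by (simp only: e'[symmetric] ee eq)
    qed
    have "q \<otimes> p = e \<otimes> z \<otimes> (e \<otimes> p)" unfolding zq[symmetric] using ec zc pc by (simp add: m_assoc)
    also have "\<dots> = e \<otimes> (z \<otimes> p)" unfolding ep using ec zc pc by (simp add: m_assoc)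
    finally show ?thesis by (simp only: e'[symmetric] ee)
  qed
  have qa: "q \<otimes> a = a \<otimes> q"
  proof -
    have "q \<otimes> a = q \<otimes> (a \<otimes> e)" using qe qc ec a by (simp only: ae) (simp add: m_assoc[symmetric])
    also have "\<dots> = q \<otimes> (a \<otimes> p) \<otimes> q" using qc a pc by (simp add: pq[symmetric] m_assoc)
    also have "\<dots> = (q \<otimes> p) \<otimes> a \<otimes> q" unfolding ap using qc a pc by (simp add: m_assoc)
    also have "\<dots> = a \<otimes> (e \<otimes> q)" unfolding qp ae[symmetric] using qc a ec by (simp add: m_assoc)
    finally show ?thesis by (simp only: eq)
  qed
  obtain m where m: "k = Suc m" using k by (cases k) auto
  \<comment> \<open>Here m = k - 1, so a v = a^k q = p q = e; this is where k > 0 enters.\<close>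
  define v where "v = a [^] m \<otimes> q"
  define f where "f = \<one> \<ominus> e"
  define w where "w = f \<otimes> a"
  have am: "a [^] m \<in> carrier R" using a by simp
  have vc: "v \<in> carrier R" and fc: "f \<in> carrier R" and wc: "w \<in> carrier R"
    using am qc ec a by (auto simp: v_def f_def w_def)
  have va: "v \<otimes> a = e"
  proof -
    have "v \<otimes> a = (a [^] m \<otimes> a) \<otimes> q" using am qc a qa by (simp add: v_def m_assoc)
    then show ?thesis using pq by (simp add: p_def m)
  qed
  have av: "a \<otimes> v = e"
  proof -
    have "a \<otimes> v = (a \<otimes> a [^] m) \<otimes> q" using am qc a by (simp add: v_def m_assoc)
    then show ?thesis using pq nat_pow_Suc2[OF a, of m] by (simp add: p_def m)
  qed
  have ve: "v \<otimes> e = v" using am qc ec qe by (simp add: v_def m_assoc)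
  have ev: "e \<otimes> v = v"
  proof -
    have "e \<otimes> v = v \<otimes> a \<otimes> v" by (simp only: va)
    also have "\<dots> = v \<otimes> e" using vc a by (simp add: m_assoc av)
    finally show ?thesis by (simp only: ve)
  qed
  have ef: "e \<otimes> f = \<zero>" and fe: "f \<otimes> e = \<zero>" and ff: "f \<otimes> f = f"
    using ec ee by (simp_all add: f_def minus_eq l_distr r_distr l_minus r_minus r_neg a_ac r_neg1 r_neg2)
  have efs: "e \<oplus> f = \<one>"
    using ec by (simp add: f_def minus_eq a_comm[of \<one>] r_neg2)
  have vf: "v \<otimes> f = \<zero>" using vc ec ve by (simp add: f_def minus_eq r_distr r_minus r_neg)
  have fv: "f \<otimes> v = \<zero>" using vc ec ev by (simp add: f_def minus_eq l_distr l_minus r_neg)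
  have af: "a \<otimes> f = f \<otimes> a" using a ec ae by (simp add: f_def minus_eq l_distr r_distr l_minus r_minus)
  have aec: "a \<otimes> e \<in> carrier R" using a ec by simp
  have faez: "f \<otimes> (a \<otimes> e) = \<zero>" unfolding ae using fc ec a by (simp add: m_assoc[symmetric] fe)
  have aefz: "a \<otimes> e \<otimes> f = \<zero>" using fc ec a by (simp add: m_assoc ef)
  have "(v \<oplus> f) \<otimes> (a \<otimes> e \<oplus> f) = v \<otimes> a \<otimes> e \<oplus> f \<otimes> (a \<otimes> e) \<oplus> (v \<otimes> f \<oplus> f \<otimes> f)"
    using vc fc a ec by (simp add: l_distr r_distr m_assoc)
  then have 1: "(v \<oplus> f) \<otimes> (a \<otimes> e \<oplus> f) = \<one>"
    using ec fc by (simp add: va ee vf faez ff efs)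
  have "(a \<otimes> e \<oplus> f) \<otimes> (v \<oplus> f) = a \<otimes> (e \<otimes> v) \<oplus> f \<otimes> v \<oplus> (a \<otimes> e \<otimes> f \<oplus> f \<otimes> f)"
    using vc fc a ec by (simp add: l_distr r_distr m_assoc)
  then have 2: "(a \<otimes> e \<oplus> f) \<otimes> (v \<oplus> f) = \<one>"
    using ec fc by (simp add: ev av fv aefz ff efs)
  have unit: "v \<oplus> f \<in> Units R" using 1 2 vc fc aec by (auto simp: Units_def)
  have "(v \<oplus> f) \<otimes> a = e \<oplus> w" using vc fc a by (simp add: l_distr va w_def)
  moreover have "nilpotent R w"
  proof -
    have "w [^] k = f [^] k \<otimes> p"
      unfolding w_def p_def by (rule pow_mult_distrib) (use af fc a in auto)
    moreover have "f [^] Suc j = f" for j :: nat by (induction j) (use ff fc in auto)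
    ultimately have "w [^] k = f \<otimes> p" by (simp only: m)
    also have "\<dots> = \<zero>" using pc ec ep by (simp add: f_def minus_eq l_distr l_minus r_neg)
    finally show ?thesis using k wc by (auto simp: nilpotent_def)
  qed
  moreover have "e \<otimes> w = w \<otimes> e"
  proof -
    have "e \<otimes> w = \<zero>" using ec fc a by (simp add: w_def m_assoc[symmetric] ef)
    moreover have "w \<otimes> e = \<zero>" using ec fc a faez by (simp add: w_def m_assoc)
    ultimately show ?thesis by simp
  qed
  ultimately have "strongly_nil_clean R ((v \<oplus> f) \<otimes> a)"
    unfolding strongly_nil_clean_def using ec wc ee by blast
  then show ?thesis using unit by blast
qed

section \<open>Group rings over division rings\<close>

lemma finsum_opposite_ring [simp]: "finsum (opposite_ring R) f I = finsum R f I"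
  by (simp add: finsum_def opposite_ring_def)

text \<open>A homogeneous linear system with more unknowns (indexed by I) than equations (indexed by
  Y) has a nonzero solution. The unknowns stand on the right, so equations may be multiplied on the
  left: Gaussian elimination with pivot \<open>v j x0\<close> removes one equation and one
  unknown.\<close>

lemma (in ring) division_ring_dependence:
  fixes Y :: "'x set" and I :: "'i set" and v :: "'i \<Rightarrow> 'x \<Rightarrow> 'a"
  assumes div: "\<And>x. x \<in> carrier R \<Longrightarrow> x \<noteq> \<zero> \<Longrightarrow> x \<in> Units R" and "\<one> \<noteq> \<zero>"
    and "finite Y" "finite I" "card Y < card I"
    and "\<And>i x. i \<in> I \<Longrightarrow> x \<in> Y \<Longrightarrow> v i x \<in> carrier R"
  shows "\<exists>d. d \<in> I \<rightarrow> carrier R \<and> (\<exists>i\<in>I. d i \<noteq> \<zero>) \<and> (\<forall>x\<in>Y. (\<Oplus>i\<in>I. v i x \<otimes> d i) = \<zero>)"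
  using assms(3-6)
proof (induction Y arbitrary: I v)
  case empty
  then have "I \<noteq> {}" by auto
  then show ?case using assms(2) by (intro exI[of _ "\<lambda>_. \<one>"]) auto
next
  case (insert x0 Y)
  show ?case
  proof (cases "\<forall>i\<in>I. v i x0 = \<zero>")
    case True
    have "card Y < card I" using insert by simp
    then obtain d where d: "d \<in> I \<rightarrow> carrier R" "\<exists>i\<in>I. d i \<noteq> \<zero>" "\<forall>x\<in>Y. (\<Oplus>i\<in>I. v i x \<otimes> d i) = \<zero>"
      using insert.IH[of I v] insert.prems by auto
    have "(\<Oplus>i\<in>I. v i x0 \<otimes> d i) = \<zero>"
      using True d(1) by (intro add.finprod_one_eqI) (auto simp: Pi_iff)
    then show ?thesis using d by blast
  next
    case False
    then obtain j where j: "j \<in> I" "v j x0 \<noteq> \<zero>" by blast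
    define r where "r = inv (v j x0)"
    have vj: "v j x0 \<in> Units R" using div j insert.prems by auto
    have rc: "r \<in> carrier R" using vj by (simp add: r_def)
    define J where "J = I - {j}"
    have J: "finite J" "j \<notin> J" "I = insert j J" "card Y < card J"
      using insert.hyps insert.prems j by (auto simp: J_def)
    have vI: "v i x \<in> carrier R" if "i \<in> I" "x \<in> insert x0 Y" for i x using insert.prems that by auto
    \<comment> \<open>Row x minus the left multiple of row x0 that cancels its entry in the pivot
      column j.\<close>
    define w where "w i x = v i x \<oplus> \<ominus> (v j x \<otimes> r) \<otimes> v i x0" for i x
    have "w i x \<in> carrier R" if "i \<in> J" "x \<in> Y" for i x using that vI rc J by (auto simp: w_def)
    then obtain d where d: "d \<in> J \<rightarrow> carrier R" "\<exists>i\<in>J. d i \<noteq> \<zero>" "\<forall>x\<in>Y. (\<Oplus>i\<in>J. w i x \<otimes> d i) = \<zero>"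
      using insert.IH[of J w] J by auto
    define s where "s = (\<Oplus>i\<in>J. v i x0 \<otimes> d i)"
    \<comment> \<open>Back substitution: the pivot unknown is chosen to solve equation x0.\<close>
    define d' where "d' = d(j := \<ominus> (r \<otimes> s))"
    have sc: "s \<in> carrier R" using d(1) vI J by (auto simp: s_def intro!: finsum_closed)
    have c: "d' \<in> I \<rightarrow> carrier R" using d(1) rc sc J by (auto simp: d'_def)
    have nz: "\<exists>i\<in>I. d' i \<noteq> \<zero>" using d(2) J by (auto simp: d'_def)
    have split: "(\<Oplus>i\<in>I. v i x \<otimes> d' i) = \<ominus> (v j x \<otimes> r) \<otimes> s \<oplus> (\<Oplus>i\<in>J. v i x \<otimes> d i)"
      if x: "x \<in> insert x0 Y" for x
    proof -
      have "(\<Oplus>i\<in>I. v i x \<otimes> d' i) = v j x \<otimes> d' j \<oplus> (\<Oplus>i\<in>J. v i x \<otimes> d' i)"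
        unfolding J(3) using J c vI x by (intro finsum_insert) auto
      also have "(\<Oplus>i\<in>J. v i x \<otimes> d' i) = (\<Oplus>i\<in>J. v i x \<otimes> d i)"
        by (rule finsum_cong') (use J d vI x in \<open>auto simp: d'_def\<close>)
      also have "v j x \<otimes> d' j = \<ominus> (v j x \<otimes> r) \<otimes> s"
        using vI[of j x] x j rc sc by (simp add: d'_def l_minus r_minus m_assoc)
      finally show ?thesis .
    qed
    have "(\<Oplus>i\<in>I. v i x0 \<otimes> d' i) = \<zero>"
      using split[of x0] vj sc Units_closed[OF vj]
      by (simp add: r_def s_def[symmetric] l_minus l_neg)
    moreover have "(\<Oplus>i\<in>I. v i x \<otimes> d' i) = \<zero>" if x: "x \<in> Y" for x
    proof -
      let ?c = "\<ominus> (v j x \<otimes> r)"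
      have cc: "?c \<in> carrier R" using vI[of j x] x j rc by simp
      have 1: "(\<lambda>i. v i x \<otimes> d i) \<in> J \<rightarrow> carrier R" "(\<lambda>i. v i x0 \<otimes> d i) \<in> J \<rightarrow> carrier R"
        using vI x d(1) J by auto
      have 2: "(\<lambda>i. ?c \<otimes> (v i x0 \<otimes> d i)) \<in> J \<rightarrow> carrier R" using 1(2) cc by auto
      have "(\<Oplus>i\<in>J. w i x \<otimes> d i) = (\<Oplus>i\<in>J. v i x \<otimes> d i \<oplus> ?c \<otimes> (v i x0 \<otimes> d i))"
      proof (rule finsum_cong')
        fix i assume i: "i \<in> J"
        have "v i x \<in> carrier R" "v i x0 \<in> carrier R" "d i \<in> carrier R" using i vI x d(1) J by auto
        then show "w i x \<otimes> d i = v i x \<otimes> d i \<oplus> ?c \<otimes> (v i x0 \<otimes> d i)"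
          using cc by (simp add: w_def l_distr m_assoc del: a_inv_closed)
      qed (use 1 2 in auto)
      also have "\<dots> = (\<Oplus>i\<in>J. v i x \<otimes> d i) \<oplus> (\<Oplus>i\<in>J. ?c \<otimes> (v i x0 \<otimes> d i))"
        by (rule finsum_addf[OF 1(1) 2])
      also have "(\<Oplus>i\<in>J. ?c \<otimes> (v i x0 \<otimes> d i)) = ?c \<otimes> s"
        unfolding s_def by (rule finsum_rdistr[symmetric]) (use J cc 1 in auto)
      also have "(\<Oplus>i\<in>J. v i x \<otimes> d i) \<oplus> ?c \<otimes> s = (\<Oplus>i\<in>I. v i x \<otimes> d' i)"
        using split[of x] x cc sc finsum_closed[OF 1(1)] by (simp add: a_comm)
      finally show ?thesis using d(3) x by simp
    qed
    ultimately show ?thesis using c nz by blast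
  qed
qed

text \<open>Take the least m with t m nonzero. The relation reads a^m t_m = - a^(m+1) c, and
  cancelling the unit t_m gives absorption at exponent m. Multiplying by a^(k-m) on the left raises
  the exponent to the prescribed k. The coefficients need not commute with a.\<close>

lemma (in ring) power_right_absorb_if_dependent:
  assumes a: "a \<in> carrier R" and t: "t \<in> {..k::nat} \<rightarrow> carrier R"
    and sum: "(\<Oplus>i\<in>{..k}. a [^] i \<otimes> t i) = \<zero>"
    and nz: "\<exists>i\<le>k. t i \<noteq> \<zero>" and unit: "\<And>i. i \<le> k \<Longrightarrow> t i \<noteq> \<zero> \<Longrightarrow> t i \<in> Units R"
  shows "\<exists>b\<in>carrier R. a [^] k = a [^] Suc k \<otimes> b"
proof -
  define m where "m = (LEAST i. i \<le> k \<and> t i \<noteq> \<zero>)"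
  have m: "m \<le> k" "t m \<noteq> \<zero>" using LeastI_ex[OF nz] by (auto simp: m_def)
  have least: "t i = \<zero>" if "i < m" for i using not_less_Least[of i "\<lambda>i. i \<le> k \<and> t i \<noteq> \<zero>"] that m(1) unfolding m_def[symmetric] by auto
  have tc: "t i \<in> carrier R" if "i \<le> k" for i using t that by auto
  \<comment> \<open>Partial sums vanish before index m; from m on, everything except the m-th term
    has a left factor a^(m+1).\<close>
  have "(n < m \<longrightarrow> (\<Oplus>i\<in>{..n}. a [^] i \<otimes> t i) = \<zero>) \<and>
      (m \<le> n \<longrightarrow> (\<exists>c\<in>carrier R. (\<Oplus>i\<in>{..n}. a [^] i \<otimes> t i) = a [^] m \<otimes> t m \<oplus> a [^] Suc m \<otimes> c))"
    if "n \<le> k" for n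
    using that
  proof (induction n)
    case 0
    show ?case using least a tc[of 0] by (auto intro!: bexI[of _ "\<zero>"] simp del: Group.nat_pow_Suc nat_pow_Suc)
  next
    case (Suc n)
    have S: "(\<Oplus>i\<in>{..Suc n}. a [^] i \<otimes> t i) = a [^] Suc n \<otimes> t (Suc n) \<oplus> (\<Oplus>i\<in>{..n}. a [^] i \<otimes> t i)"
      using a tc Suc.prems by (intro finsum_Suc) auto
    consider "Suc n < m" | "Suc n = m" | "m \<le> n" by linarith
    then show ?case
    proof cases
      case 1
      then show ?thesis using S Suc least[of "Suc n"] a by auto
    next
      case 2
      then show ?thesis using S Suc a tc[of m] m
        by (auto intro!: bexI[of _ "\<zero>"] simp del: Group.nat_pow_Suc nat_pow_Suc)
    next
      case 3
      then obtain c where c: "c \<in> carrier R" "(\<Oplus>i\<in>{..n}. a [^] i \<otimes> t i) = a [^] m \<otimes> t m \<oplus> a [^] Suc m \<otimes> c"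
        using Suc by auto
      let ?e = "a [^] (n - m) \<otimes> t (Suc n)"
      have e: "?e \<in> carrier R" using a tc Suc.prems by auto
      have "a [^] Suc n = a [^] Suc m \<otimes> a [^] (n - m)"
        using nat_pow_mult[OF a, of "Suc m" "n - m"] 3 by (simp del: Group.nat_pow_Suc nat_pow_Suc)
      then have "a [^] Suc n \<otimes> t (Suc n) = a [^] Suc m \<otimes> ?e"
        using a tc[OF Suc.prems] by (simp add: m_assoc del: Group.nat_pow_Suc nat_pow_Suc)
      then have "(\<Oplus>i\<in>{..Suc n}. a [^] i \<otimes> t i) = a [^] m \<otimes> t m \<oplus> a [^] Suc m \<otimes> (?e \<oplus> c)"
        unfolding S c(2) using c(1) e a tc[OF m(1)]
        by (simp add: r_distr a_lcomm del: Group.nat_pow_Suc nat_pow_Suc)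
      then show ?thesis using 3 c(1) e by auto
    qed
  qed
  from this[of k] m sum obtain c where c: "c \<in> carrier R" "a [^] m \<otimes> t m \<oplus> a [^] Suc m \<otimes> c = \<zero>" by auto
  have tm: "t m \<in> Units R" using unit m by auto
  have tmc: "t m \<in> carrier R" using tc m by auto
  let ?b = "\<ominus> c \<otimes> inv t m"
  have b: "?b \<in> carrier R" using c tm by auto
  have "a [^] m \<otimes> t m = \<ominus> (a [^] Suc m \<otimes> c)"
    using c a tmc by (intro minus_equality[symmetric]) auto
  then have "a [^] m \<otimes> t m \<otimes> inv t m = a [^] Suc m \<otimes> ?b"
    using c a tm by (simp add: l_minus r_minus m_assoc)
  then have "a [^] m = a [^] Suc m \<otimes> ?b"
    using a tm tmc by (simp add: m_assoc del: Group.nat_pow_Suc nat_pow_Suc)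
  moreover have "a [^] k = a [^] (k - m) \<otimes> a [^] m" "a [^] Suc k = a [^] (k - m) \<otimes> a [^] Suc m"
    using nat_pow_mult[OF a, of "k - m" m] nat_pow_mult[OF a, of "k - m" "Suc m"] m
    by (simp_all del: Group.nat_pow_Suc nat_pow_Suc)
  ultimately have "a [^] k = a [^] Suc k \<otimes> ?b"
    using a b by (metis m_assoc nat_pow_closed)
  then show ?thesis using b by blast
qed

section \<open>Constants in the group ring and elements supported on a finite subgroup\<close>

definition gr_const :: "('a, 'm) ring_scheme \<Rightarrow> ('g, 'n) monoid_scheme \<Rightarrow> 'a \<Rightarrow> 'g \<Rightarrow> 'a" where
  "gr_const R G d = (\<lambda>g\<in>carrier G. if g = \<one>\<^bsub>G\<^esub> then d else \<zero>\<^bsub>R\<^esub>)"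

context group_ring_setup
begin

sublocale RG: ring RG by (rule ring_RG)

lemma finsum_coeff:
  assumes "\<And>i. i \<in> I \<Longrightarrow> f i \<in> carrier RG" "x \<in> carrier G"
  shows "finsum RG f I x = finsum R (\<lambda>i. f i x) I"
proof (cases "finite I")
  case True
  then show ?thesis using assms
  proof (induction I)
    case (insert i I)
    then show ?case by (simp add: RG.finsum_insert R.finsum_insert add_coeff Pi_def coeff_closed)
  qed (simp add: zero_coeff)
qed (use assms in \<open>simp add: RG.finsum_infinite R.finsum_infinite zero_coeff\<close>)

lemma const_in: "d \<in> carrier R \<Longrightarrow> gr_const R G d \<in> carrier RG"
  by (rule group_ring_memI[of "{\<one>\<^bsub>G\<^esub>}"]) (auto simp: gr_const_def)

lemma const_zero: "gr_const R G \<zero>\<^bsub>R\<^esub> = \<zero>\<^bsub>RG\<^esub>"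
  by (auto simp: gr_const_def group_ring_def)

lemma const_eq_zero_iff: "gr_const R G d = \<zero>\<^bsub>RG\<^esub> \<longleftrightarrow> d = \<zero>\<^bsub>R\<^esub>"
proof
  assume "gr_const R G d = \<zero>\<^bsub>RG\<^esub>"
  from fun_cong[OF this, of "\<one>\<^bsub>G\<^esub>"] show "d = \<zero>\<^bsub>R\<^esub>"
    by (simp add: zero_coeff gr_const_def)
qed (simp add: const_zero)

lemma const_one: "gr_const R G \<one>\<^bsub>R\<^esub> = \<one>\<^bsub>RG\<^esub>"
  by (simp add: gr_const_def group_ring_def)

lemma const_mult_coeff:
  assumes "d \<in> carrier R" "f \<in> carrier RG" "x \<in> carrier G"
  shows "(gr_const R G d \<otimes>\<^bsub>RG\<^esub> f) x = d \<otimes>\<^bsub>R\<^esub> f x"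
proof -
  have "(gr_const R G d \<otimes>\<^bsub>RG\<^esub> f) x
      = (\<Oplus>\<^bsub>R\<^esub>y\<in>{\<one>\<^bsub>G\<^esub>}. gr_const R G d y \<otimes>\<^bsub>R\<^esub> f (inv\<^bsub>G\<^esub> y \<otimes>\<^bsub>G\<^esub> x))"
    using assms const_in by (intro mult_coeff) (auto simp: gr_supp_def gr_const_def split: if_splits)
  then show ?thesis using assms coeff_closed by (simp add: gr_const_def)
qed

lemma mult_const_coeff:
  assumes "d \<in> carrier R" "f \<in> carrier RG" "x \<in> carrier G"
  shows "(f \<otimes>\<^bsub>RG\<^esub> gr_const R G d) x = f x \<otimes>\<^bsub>R\<^esub> d"
proof -
  have e: "inv\<^bsub>G\<^esub> y \<otimes>\<^bsub>G\<^esub> x = \<one>\<^bsub>G\<^esub> \<longleftrightarrow> x = y" if "y \<in> carrier G" for y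
    using assms that by (metis G.inv_solve_left G.one_closed G.r_one)
  have "(f \<otimes>\<^bsub>RG\<^esub> gr_const R G d) x
      = (\<Oplus>\<^bsub>R\<^esub>y\<in>insert x (supp f). f y \<otimes>\<^bsub>R\<^esub> gr_const R G d (inv\<^bsub>G\<^esub> y \<otimes>\<^bsub>G\<^esub> x))"
    by (rule mult_coeff) (use assms const_in finite_supp supp_in_carrier in auto)
  also have "\<dots> = (\<Oplus>\<^bsub>R\<^esub>y\<in>insert x (supp f). if x = y then f y \<otimes>\<^bsub>R\<^esub> d else \<zero>\<^bsub>R\<^esub>)"
    by (rule R.finsum_cong') (use assms supp_in_carrier coeff_closed e in \<open>auto simp: gr_const_def\<close>)
  also have "\<dots> = f x \<otimes>\<^bsub>R\<^esub> d"
    by (rule R.finsum_singleton) (use assms finite_supp supp_in_carrier coeff_closed in auto)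
  finally show ?thesis .
qed

lemma const_Units: assumes "d \<in> Units R" shows "gr_const R G d \<in> Units RG"
proof -
  have c: "d \<in> carrier R" "inv\<^bsub>R\<^esub> d \<in> carrier R" using assms by auto
  have "gr_const R G d \<otimes>\<^bsub>RG\<^esub> gr_const R G (inv\<^bsub>R\<^esub> d) = \<one>\<^bsub>RG\<^esub>"
    "gr_const R G (inv\<^bsub>R\<^esub> d) \<otimes>\<^bsub>RG\<^esub> gr_const R G d = \<one>\<^bsub>RG\<^esub>"
    unfolding const_one[symmetric]
    by (rule group_ring_eqI; use assms c in \<open>auto simp: const_in const_mult_coeff\<close>; simp add: gr_const_def)+
  then show ?thesis using c const_in by (auto simp: Units_def)
qed

lemma supp_mult_subgroup:
  assumes H: "subgroup H G" and f: "f \<in> carrier RG" "supp f \<subseteq> H" and h: "h \<in> carrier RG" "supp h \<subseteq> H"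
  shows "supp (f \<otimes>\<^bsub>RG\<^esub> h) \<subseteq> H"
proof
  fix x assume x: "x \<in> supp (f \<otimes>\<^bsub>RG\<^esub> h)"
  show "x \<in> H"
  proof (rule ccontr)
    assume nx: "x \<notin> H"
    have xc: "x \<in> carrier G" using x supp_in_carrier by auto
    have z: "f y \<otimes>\<^bsub>R\<^esub> h (inv\<^bsub>G\<^esub> y \<otimes>\<^bsub>G\<^esub> x) = \<zero>\<^bsub>R\<^esub>" if y: "y \<in> supp f" for y
    proof -
      have yH: "y \<in> H" and yc: "y \<in> carrier G" using y f supp_in_carrier by auto
      have "x = y \<otimes>\<^bsub>G\<^esub> (inv\<^bsub>G\<^esub> y \<otimes>\<^bsub>G\<^esub> x)" using yc xc by (simp add: G.m_assoc[symmetric])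
      then have "inv\<^bsub>G\<^esub> y \<otimes>\<^bsub>G\<^esub> x \<notin> H" using nx yH subgroup.m_closed[OF H] by metis
      then have "inv\<^bsub>G\<^esub> y \<otimes>\<^bsub>G\<^esub> x \<notin> supp h" using h by blast
      then have "h (inv\<^bsub>G\<^esub> y \<otimes>\<^bsub>G\<^esub> x) = \<zero>\<^bsub>R\<^esub>" using yc xc by (simp add: gr_supp_def)
      then show ?thesis using f yc coeff_closed by auto
    qed
    have "(f \<otimes>\<^bsub>RG\<^esub> h) x = (\<Oplus>\<^bsub>R\<^esub>y\<in>supp f. f y \<otimes>\<^bsub>R\<^esub> h (inv\<^bsub>G\<^esub> y \<otimes>\<^bsub>G\<^esub> x))"
      using f h xc finite_supp supp_in_carrier by (intro mult_coeff) auto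
    also have "\<dots> = \<zero>\<^bsub>R\<^esub>" by (rule R.add.finprod_one_eqI[simplified]) (use z in auto)
    finally show False using x by (simp add: gr_supp_def)
  qed
qed

text \<open>Confines all powers of a to the functions on H, a space with \<open>card H\<close>
  coordinates.\<close>

lemma supp_pow_subgroup:
  assumes H: "subgroup H G" and a: "a \<in> carrier RG" "supp a \<subseteq> H"
  shows "supp (a [^]\<^bsub>RG\<^esub> (n::nat)) \<subseteq> H"
proof (induction n)
  case 0
  show ?case using subgroup.one_closed[OF H] by (auto simp: gr_supp_def one_coeff split: if_splits)
next
  case (Suc n)
  then show ?case using supp_mult_subgroup[OF H _ _ a] a by simp
qed

text \<open>The \<open>card H\<close> + 1 powers have only \<open>card H\<close> coordinates, so
  they are dependent with scalars on the right. Right multiplication by \<open>gr_const\<close>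
  multiplies coefficients on the right, and nonzero constants are units of the group ring, as
  \<open>power_right_absorb_if_dependent\<close> requires.\<close>

lemma division_ring_power_right_absorb:
  assumes div: "\<And>x. x \<in> carrier R \<Longrightarrow> x \<noteq> \<zero>\<^bsub>R\<^esub> \<Longrightarrow> x \<in> Units R" and nt: "\<one>\<^bsub>R\<^esub> \<noteq> \<zero>\<^bsub>R\<^esub>"
    and H: "subgroup H G" "finite H" and a: "a \<in> carrier RG" "supp a \<subseteq> H"
  shows "\<exists>b\<in>carrier RG. a [^]\<^bsub>RG\<^esub> card H = a [^]\<^bsub>RG\<^esub> Suc (card H) \<otimes>\<^bsub>RG\<^esub> b"
proof -
  let ?k = "card H"
  let ?v = "\<lambda>i x. (a [^]\<^bsub>RG\<^esub> (i::nat)) x"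
  have HG: "H \<subseteq> carrier G" using subgroup.subset[OF H(1)] .
  have pc: "a [^]\<^bsub>RG\<^esub> i \<in> carrier RG" for i :: nat using a by simp
  have vc: "?v i x \<in> carrier R" if "x \<in> H" for i x using coeff_closed[OF pc] HG that by blast
  obtain d where d: "d \<in> {..?k} \<rightarrow> carrier R" "\<exists>i\<in>{..?k}. d i \<noteq> \<zero>\<^bsub>R\<^esub>"
    "\<forall>x\<in>H. (\<Oplus>\<^bsub>R\<^esub>i\<in>{..?k}. ?v i x \<otimes>\<^bsub>R\<^esub> d i) = \<zero>\<^bsub>R\<^esub>"
    using R.division_ring_dependence[of H "{..?k}" ?v, OF div nt H(2)] vc by auto
  have dc: "d i \<in> carrier R" if "i \<le> ?k" for i using d(1) that by auto
  define t where "t = (\<lambda>i. gr_const R G (d i))"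
  have t: "t \<in> {..?k} \<rightarrow> carrier RG" using dc const_in by (auto simp: t_def)
  have tnz: "t i = \<zero>\<^bsub>RG\<^esub> \<longleftrightarrow> d i = \<zero>\<^bsub>R\<^esub>" for i
    by (simp add: t_def const_eq_zero_iff)
  have vz: "?v i x = \<zero>\<^bsub>R\<^esub>" if "x \<in> carrier G" "x \<notin> H" for i x
    using supp_pow_subgroup[OF H(1) a, of i] that by (auto simp: gr_supp_def)
  have sum: "(\<Oplus>\<^bsub>RG\<^esub>i\<in>{..?k}. a [^]\<^bsub>RG\<^esub> i \<otimes>\<^bsub>RG\<^esub> t i) = \<zero>\<^bsub>RG\<^esub>"
  proof (rule group_ring_eqI)
    show "(\<Oplus>\<^bsub>RG\<^esub>i\<in>{..?k}. a [^]\<^bsub>RG\<^esub> i \<otimes>\<^bsub>RG\<^esub> t i) \<in> carrier RG"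
      using t a by (intro RG.finsum_closed) auto
    fix x assume x: "x \<in> carrier G"
    have "(\<Oplus>\<^bsub>RG\<^esub>i\<in>{..?k}. a [^]\<^bsub>RG\<^esub> i \<otimes>\<^bsub>RG\<^esub> t i) x
        = (\<Oplus>\<^bsub>R\<^esub>i\<in>{..?k}. (a [^]\<^bsub>RG\<^esub> i \<otimes>\<^bsub>RG\<^esub> t i) x)"
      using t a x by (intro finsum_coeff) auto
    also have "\<dots> = (\<Oplus>\<^bsub>R\<^esub>i\<in>{..?k}. ?v i x \<otimes>\<^bsub>R\<^esub> d i)"
      by (rule R.finsum_cong') (use dc x pc coeff_closed[OF pc x] in \<open>auto simp: t_def mult_const_coeff\<close>)
    also have "\<dots> = \<zero>\<^bsub>R\<^esub>"
    proof (cases "x \<in> H")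
      case False
      then show ?thesis using vz[OF x] dc by (intro R.add.finprod_one_eqI[simplified]) auto
    qed (use d(3) in auto)
    finally show "(\<Oplus>\<^bsub>RG\<^esub>i\<in>{..?k}. a [^]\<^bsub>RG\<^esub> i \<otimes>\<^bsub>RG\<^esub> t i) x = \<zero>\<^bsub>RG\<^esub> x"
      using x by (simp add: zero_coeff)
  qed simp
  show ?thesis
  proof (rule RG.power_right_absorb_if_dependent[OF a(1) t sum])
    show "\<exists>i\<le>?k. t i \<noteq> \<zero>\<^bsub>RG\<^esub>" using d(2) tnz by auto
    show "t i \<in> Units RG" if "i \<le> ?k" "t i \<noteq> \<zero>\<^bsub>RG\<^esub>" for i
      using that tnz dc div const_Units by (auto simp: t_def)
  qed
qed

text \<open>The group ring over the opposite coefficients is the opposite of the group ring only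
  after inverting group elements. The passage to opposites is therefore made separately: in R for
  the linear dependence, in the group ring for the absorption.\<close>

lemma division_ring_power_left_absorb:
  assumes div: "\<And>x. x \<in> carrier R \<Longrightarrow> x \<noteq> \<zero>\<^bsub>R\<^esub> \<Longrightarrow> x \<in> Units R" and nt: "\<one>\<^bsub>R\<^esub> \<noteq> \<zero>\<^bsub>R\<^esub>"
    and H: "subgroup H G" "finite H" and a: "a \<in> carrier RG" "supp a \<subseteq> H"
  shows "\<exists>b\<in>carrier RG. a [^]\<^bsub>RG\<^esub> card H = b \<otimes>\<^bsub>RG\<^esub> a [^]\<^bsub>RG\<^esub> Suc (card H)"
proof -
  interpret opR: ring "opposite_ring R" by (rule R.ring_opposite_ring)
  interpret opRG: ring "opposite_ring RG" by (rule RG.ring_opposite_ring)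
  let ?k = "card H"
  let ?v = "\<lambda>i x. (a [^]\<^bsub>RG\<^esub> (i::nat)) x"
  have HG: "H \<subseteq> carrier G" using subgroup.subset[OF H(1)] .
  have pc: "a [^]\<^bsub>RG\<^esub> i \<in> carrier RG" for i :: nat using a by simp
  have vc: "?v i x \<in> carrier R" if "x \<in> H" for i x using coeff_closed[OF pc] HG that by blast
  obtain d where d: "d \<in> {..?k} \<rightarrow> carrier R" "\<exists>i\<in>{..?k}. d i \<noteq> \<zero>\<^bsub>R\<^esub>"
    "\<forall>x\<in>H. (\<Oplus>\<^bsub>R\<^esub>i\<in>{..?k}. d i \<otimes>\<^bsub>R\<^esub> ?v i x) = \<zero>\<^bsub>R\<^esub>"
    using opR.division_ring_dependence[of H "{..?k}" ?v] div nt H(2) vc by auto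
  have dc: "d i \<in> carrier R" if "i \<le> ?k" for i using d(1) that by auto
  define t where "t = (\<lambda>i. gr_const R G (d i))"
  have t: "t \<in> {..?k} \<rightarrow> carrier RG" using dc const_in by (auto simp: t_def)
  have tnz: "t i = \<zero>\<^bsub>RG\<^esub> \<longleftrightarrow> d i = \<zero>\<^bsub>R\<^esub>" for i
    by (simp add: t_def const_eq_zero_iff)
  have vz: "?v i x = \<zero>\<^bsub>R\<^esub>" if "x \<in> carrier G" "x \<notin> H" for i x
    using supp_pow_subgroup[OF H(1) a, of i] that by (auto simp: gr_supp_def)
  have sum: "(\<Oplus>\<^bsub>RG\<^esub>i\<in>{..?k}. t i \<otimes>\<^bsub>RG\<^esub> a [^]\<^bsub>RG\<^esub> i) = \<zero>\<^bsub>RG\<^esub>"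
  proof (rule group_ring_eqI)
    show "(\<Oplus>\<^bsub>RG\<^esub>i\<in>{..?k}. t i \<otimes>\<^bsub>RG\<^esub> a [^]\<^bsub>RG\<^esub> i) \<in> carrier RG"
      using t a by (intro RG.finsum_closed) auto
    fix x assume x: "x \<in> carrier G"
    have "(\<Oplus>\<^bsub>RG\<^esub>i\<in>{..?k}. t i \<otimes>\<^bsub>RG\<^esub> a [^]\<^bsub>RG\<^esub> i) x
        = (\<Oplus>\<^bsub>R\<^esub>i\<in>{..?k}. (t i \<otimes>\<^bsub>RG\<^esub> a [^]\<^bsub>RG\<^esub> i) x)"
      using t a x by (intro finsum_coeff) auto
    also have "\<dots> = (\<Oplus>\<^bsub>R\<^esub>i\<in>{..?k}. d i \<otimes>\<^bsub>R\<^esub> ?v i x)"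
      by (rule R.finsum_cong') (use dc x pc coeff_closed[OF pc x] in \<open>auto simp: t_def const_mult_coeff\<close>)
    also have "\<dots> = \<zero>\<^bsub>R\<^esub>"
    proof (cases "x \<in> H")
      case False
      then show ?thesis using vz[OF x] dc by (intro R.add.finprod_one_eqI[simplified]) auto
    qed (use d(3) in auto)
    finally show "(\<Oplus>\<^bsub>RG\<^esub>i\<in>{..?k}. t i \<otimes>\<^bsub>RG\<^esub> a [^]\<^bsub>RG\<^esub> i) x = \<zero>\<^bsub>RG\<^esub> x"
      using x by (simp add: zero_coeff)
  qed simp
  have "\<exists>i\<le>?k. t i \<noteq> \<zero>\<^bsub>RG\<^esub>" using d(2) tnz by auto
  moreover have "t i \<in> Units RG" if "i \<le> ?k" "t i \<noteq> \<zero>\<^bsub>RG\<^esub>" for i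
      using that tnz dc div const_Units by (auto simp: t_def)
  ultimately show ?thesis
    using opRG.power_right_absorb_if_dependent[of a t ?k, unfolded opposite_ring_simps
      RG.opposite_ring_pow[OF a(1)] finsum_opposite_ring, OF a(1) t sum] by blast
qed

end

section \<open>Change of coefficients\<close>

definition gr_map :: "('g, 'n) monoid_scheme \<Rightarrow> ('a \<Rightarrow> 'b) \<Rightarrow> ('g \<Rightarrow> 'a) \<Rightarrow> 'g \<Rightarrow> 'b" where
  "gr_map G h f = (\<lambda>g\<in>carrier G. h (f g))"

context ring_hom_ring
begin

lemma gr_map_in:
  assumes "group G" "f \<in> carrier (group_ring R G)"
  shows "gr_map G h f \<in> carrier (group_ring S G)"
proof -
  interpret G: group G by fact
  interpret RG: group_ring_setup R G by unfold_locales
  interpret SG: group_ring_setup S G by unfold_locales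
  show ?thesis
    by (rule SG.group_ring_memI[of "RG.supp f"])
      (use assms RG.finite_supp RG.coeff_closed in \<open>auto simp: gr_map_def gr_supp_def\<close>)
qed

lemma gr_map_supp: "f \<in> carrier (group_ring R G) \<Longrightarrow> gr_supp S G (gr_map G h f) \<subseteq> gr_supp R G f"
  by (auto simp: gr_map_def gr_supp_def)

lemma gr_map_hom:
  assumes "group G"
  shows "ring_hom_ring (group_ring R G) (group_ring S G) (gr_map G h)"
proof -
  interpret G: group G by fact
  interpret RG: group_ring_setup R G by unfold_locales
  interpret SG: group_ring_setup S G by unfold_locales
  note [simp] = gr_map_in[OF assms]
  show ?thesis
  proof (rule ring_hom_ringI[OF RG.ring_RG SG.ring_RG])
    fix f k assume f: "f \<in> carrier (group_ring R G)" and k: "k \<in> carrier (group_ring R G)"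
    show "gr_map G h (f \<otimes>\<^bsub>group_ring R G\<^esub> k) = gr_map G h f \<otimes>\<^bsub>group_ring S G\<^esub> gr_map G h k"
    proof (rule SG.group_ring_eqI)
      fix x assume x: "x \<in> carrier G"
      let ?A = "gr_supp R G f"
      have A: "finite ?A" "?A \<subseteq> carrier G" using RG.finite_supp[OF f] RG.supp_in_carrier by auto
      have c: "(\<lambda>y. f y \<otimes> k (inv\<^bsub>G\<^esub> y \<otimes>\<^bsub>G\<^esub> x)) \<in> ?A \<rightarrow> carrier R"
        using A x f k RG.coeff_closed by auto
      have "gr_map G h (f \<otimes>\<^bsub>group_ring R G\<^esub> k) x = h (\<Oplus>y\<in>?A. f y \<otimes> k (inv\<^bsub>G\<^esub> y \<otimes>\<^bsub>G\<^esub> x))"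
        using x RG.mult_coeff[OF f k x A(1) _ A(2)] by (simp add: gr_map_def)
      also have "\<dots> = (\<Oplus>\<^bsub>S\<^esub>y\<in>?A. h (f y \<otimes> k (inv\<^bsub>G\<^esub> y \<otimes>\<^bsub>G\<^esub> x)))"
        using hom_finsum[OF c] by (simp add: comp_def)
      also have "\<dots> = (\<Oplus>\<^bsub>S\<^esub>y\<in>?A. gr_map G h f y \<otimes>\<^bsub>S\<^esub> gr_map G h k (inv\<^bsub>G\<^esub> y \<otimes>\<^bsub>G\<^esub> x))"
        by (rule S.finsum_cong') (use A x f k RG.coeff_closed in \<open>auto simp: gr_map_def subset_iff\<close>)
      \<comment> \<open>The homomorphism may kill coefficients, so the product is expanded over the
        old support, which contains the new one.\<close>
      also have "\<dots> = (gr_map G h f \<otimes>\<^bsub>group_ring S G\<^esub> gr_map G h k) x"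
        using f k x A gr_map_supp[OF f] by (intro SG.mult_coeff[symmetric]) auto
      finally show "gr_map G h (f \<otimes>\<^bsub>group_ring R G\<^esub> k) x
        = (gr_map G h f \<otimes>\<^bsub>group_ring S G\<^esub> gr_map G h k) x" .
    qed (use f k in auto)
    show "gr_map G h (f \<oplus>\<^bsub>group_ring R G\<^esub> k) = gr_map G h f \<oplus>\<^bsub>group_ring S G\<^esub> gr_map G h k"
      by (rule SG.group_ring_eqI)
        (use f k in \<open>auto simp: SG.add_coeff\<close>, use f k in \<open>simp add: gr_map_def RG.add_coeff RG.coeff_closed\<close>)
  next
    show "gr_map G h \<one>\<^bsub>group_ring R G\<^esub> = \<one>\<^bsub>group_ring S G\<^esub>"
      by (rule SG.group_ring_eqI) (auto, simp add: gr_map_def RG.one_coeff SG.one_coeff)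
  qed simp
qed

lemma gr_map_surj:
  assumes "group G" and surj: "h ` carrier R = carrier S"
  shows "gr_map G h ` carrier (group_ring R G) = carrier (group_ring S G)"
proof
  interpret G: group G by fact
  interpret RG: group_ring_setup R G by unfold_locales
  interpret SG: group_ring_setup S G by unfold_locales
  show "gr_map G h ` carrier (group_ring R G) \<subseteq> carrier (group_ring S G)"
    using gr_map_in[OF assms(1)] by blast
  show "carrier (group_ring S G) \<subseteq> gr_map G h ` carrier (group_ring R G)"
  proof
    fix f assume f: "f \<in> carrier (group_ring S G)"
    \<comment> \<open>Sending zero to zero keeps the support of the lifted function finite.\<close>
    define l where "l y = (if y = \<zero>\<^bsub>S\<^esub> then \<zero> else (SOME x. x \<in> carrier R \<and> h x = y))" for y
    have l: "l y \<in> carrier R \<and> h (l y) = y" if "y \<in> carrier S" for y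
    proof -
      have "y \<in> h ` carrier R" using that by (simp only: surj)
      then have "\<exists>x. x \<in> carrier R \<and> h x = y" by blast
      from someI_ex[OF this] show ?thesis by (simp add: l_def)
    qed
    have l0: "l \<zero>\<^bsub>S\<^esub> = \<zero>" by (simp add: l_def)
    have fc: "f g \<in> carrier S" if "g \<in> carrier G" for g using SG.coeff_closed[OF f that] .
    have m: "gr_map G l f \<in> carrier (group_ring R G)"
    proof (rule RG.group_ring_memI[OF SG.finite_supp[OF f]])
      fix g assume g: "g \<in> carrier G"
      show "gr_map G l f g \<in> carrier R" using l[OF fc[OF g]] g by (simp add: gr_map_def)
      assume "g \<notin> SG.supp f"
      then show "gr_map G l f g = \<zero>" using g l0 by (simp add: gr_map_def gr_supp_def)
    qed (simp add: gr_map_def)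
    have "gr_map G h (gr_map G l f) = f"
    proof (rule SG.group_ring_eqI[OF gr_map_in[OF assms(1) m] f])
      fix g assume g: "g \<in> carrier G"
      then show "gr_map G h (gr_map G l f) g = f g" using l[OF fc[OF g]] by (simp add: gr_map_def)
    qed
    then show "f \<in> gr_map G h ` carrier (group_ring R G)" using m by (metis imageI)
  qed
qed

end

lemma gr_map_eq_zero:
  assumes "gr_map G h f = \<zero>\<^bsub>group_ring S G\<^esub>" "g \<in> carrier G"
  shows "h (f g) = \<zero>\<^bsub>S\<^esub>"
  using fun_cong[OF assms(1), of g] assms(2) by (simp add: gr_map_def group_ring_def)

section \<open>Quotients, reduced rings and nil coefficient ideals\<close>

lemma (in ideal) rcos_zero_iff: "x \<in> carrier R \<Longrightarrow> I +> x = \<zero>\<^bsub>R Quot I\<^esub> \<longleftrightarrow> x \<in> I"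
  unfolding FactRing_def by simp (metis a_rcos_const a_rcos_self)

lemma (in ideal) rcos_surj: "(+>) I ` carrier R = carrier (R Quot I)"
  by (auto simp: FactRing_simps)

text \<open>The elements e r (1 - e) and (1 - e) r e square to zero, hence vanish, and e r = e r e =
  r e.\<close>

lemma (in ring) reduced_idempotent_central:
  assumes red: "\<And>x. nilpotent R x \<Longrightarrow> x = \<zero>"
    and e: "e \<in> carrier R" "e \<otimes> e = e" and r: "r \<in> carrier R"
  shows "e \<otimes> r = r \<otimes> e"
proof -
  have sq: "x = \<zero>" if "x \<in> carrier R" "x \<otimes> x = \<zero>" for x
  proof (rule red)
    have "x [^] (2::nat) = \<zero>" using that by (simp add: numeral_2_eq_2)
    then show "nilpotent R x" using that(1) unfolding nilpotent_def by (intro conjI exI[of _ 2]) auto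
  qed
  define f where "f = \<one> \<ominus> e"
  have fc: "f \<in> carrier R" and fe: "f \<otimes> e = \<zero>" and ef: "e \<otimes> f = \<zero>"
    using e by (simp_all add: f_def minus_eq l_distr r_distr l_minus r_minus r_neg)
  have 1: "e \<otimes> r \<otimes> f = \<zero>"
  proof (rule sq)
    have "(e \<otimes> r \<otimes> f) \<otimes> (e \<otimes> r \<otimes> f) = e \<otimes> r \<otimes> (f \<otimes> e) \<otimes> r \<otimes> f"
      using e(1) fc r by (simp add: m_assoc)
    then show "(e \<otimes> r \<otimes> f) \<otimes> (e \<otimes> r \<otimes> f) = \<zero>" unfolding fe using e(1) fc r by simp
  qed (use e(1) fc r in simp)
  have 2: "f \<otimes> r \<otimes> e = \<zero>"
  proof (rule sq)
    have "(f \<otimes> r \<otimes> e) \<otimes> (f \<otimes> r \<otimes> e) = f \<otimes> r \<otimes> (e \<otimes> f) \<otimes> r \<otimes> e"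
      using e(1) fc r by (simp add: m_assoc)
    then show "(f \<otimes> r \<otimes> e) \<otimes> (f \<otimes> r \<otimes> e) = \<zero>" unfolding ef using e(1) fc r by simp
  qed (use e(1) fc r in simp)
  have "e \<otimes> r \<ominus> e \<otimes> r \<otimes> e = \<zero>"
    using 1 e(1) r by (simp add: f_def minus_eq r_distr r_minus m_assoc)
  moreover have "r \<otimes> e \<ominus> e \<otimes> r \<otimes> e = \<zero>"
    using 2 e(1) r by (simp add: f_def minus_eq l_distr l_minus m_assoc)
  ultimately show ?thesis using e(1) r r_right_minus_eq[of "e \<otimes> r" "e \<otimes> r \<otimes> e"]
      r_right_minus_eq[of "r \<otimes> e" "e \<otimes> r \<otimes> e"] by simp
qed

text \<open>Centrality of c is what gives closure under left multiplication, so that the colon ideal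
  is two-sided and competes in the Zorn argument.\<close>

lemma (in ring) central_colon_ideal:
  assumes P: "ideal P R" and c: "c \<in> carrier R" and central: "\<And>r. r \<in> carrier R \<Longrightarrow> c \<otimes> r = r \<otimes> c"
  shows "ideal {x \<in> carrier R. c \<otimes> x \<in> P} R"
proof -
  interpret P: ideal P R by fact
  show ?thesis
  proof (rule idealI)
    show "subgroup {x \<in> carrier R. c \<otimes> x \<in> P} (add_monoid R)"
      by (rule add.subgroupI)
        (use c P.a_closed P.a_inv_closed in \<open>auto simp: r_distr r_minus a_inv_def[symmetric] intro!: exI[of _ "\<zero>"]\<close>)
    fix a x assume a: "a \<in> {x \<in> carrier R. c \<otimes> x \<in> P}" and x: "x \<in> carrier R"
    have "c \<otimes> (x \<otimes> a) = x \<otimes> (c \<otimes> a)" using a x c central[OF x] by (simp add: m_assoc[symmetric])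
    then show "x \<otimes> a \<in> {x \<in> carrier R. c \<otimes> x \<in> P}" using a x P.I_l_closed by auto
    have "c \<otimes> (a \<otimes> x) = (c \<otimes> a) \<otimes> x" using a x c by (simp add: m_assoc)
    then show "a \<otimes> x \<in> {x \<in> carrier R. c \<otimes> x \<in> P}" using a x P.I_r_closed by auto
  qed (rule ring_axioms)
qed

lemma (in ring) weakly_2_primal_quotient_reduced:
  assumes N: "ideal (nilpotents R) R" and x: "nilpotent (R Quot nilpotents R) x"
  shows "x = \<zero>\<^bsub>R Quot nilpotents R\<^esub>"
proof -
  interpret N: ideal "nilpotents R" R by fact
  interpret \<pi>: ring_hom_ring R "R Quot nilpotents R" "(+>) (nilpotents R)"
    by (rule N.rcos_ring_hom_ring)
  obtain n :: nat where n: "n > 0" "x [^]\<^bsub>R Quot nilpotents R\<^esub> n = \<zero>\<^bsub>R Quot nilpotents R\<^esub>"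
    and xc: "x \<in> carrier (R Quot nilpotents R)" using x by (auto simp: nilpotent_def)
  obtain y where y: "y \<in> carrier R" "x = nilpotents R +> y" using xc N.rcos_surj by blast
  have "y [^] n \<in> nilpotents R"
    using n(2) y N.rcos_zero_iff[of "y [^] n"] by (simp add: \<pi>.hom_nat_pow)
  then have "y \<in> nilpotents R"
    using nilpotent_if_pow_nilpotent[OF y(1) n(1)] unfolding nilpotents_def by simp
  then show ?thesis using y N.rcos_zero_iff by simp
qed

context group_ring_setup
begin

lemma const_central:
  assumes "c \<in> carrier R" "\<And>r. r \<in> carrier R \<Longrightarrow> c \<otimes>\<^bsub>R\<^esub> r = r \<otimes>\<^bsub>R\<^esub> c" "f \<in> carrier RG"
  shows "gr_const R G c \<otimes>\<^bsub>RG\<^esub> f = f \<otimes>\<^bsub>RG\<^esub> gr_const R G c"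
  by (rule group_ring_eqI)
    (use assms in \<open>auto simp: const_in const_mult_coeff mult_const_coeff coeff_closed\<close>)

text \<open>The finitely many coefficients of f generate a nilpotent subring, and the coefficients
  of f^n are sums of n-fold products in it.\<close>

lemma nilpotent_if_coeffs_locally_nilpotent:
  assumes N: "locally_nilpotent R N" and f: "f \<in> carrier RG" and fN: "\<And>g. g \<in> carrier G \<Longrightarrow> f g \<in> N"
  shows "nilpotent RG f"
proof -
  let ?S = "generate_rng R (f ` supp f)"
  have "finite (f ` supp f)" "f ` supp f \<subseteq> N" using finite_supp[OF f] fN supp_in_carrier by auto
  then have "nilpotent_subrng R ?S" using N by (auto simp: locally_nilpotent_def)
  then obtain n where n: "n > 0"
    "\<And>xs. set xs \<subseteq> ?S \<Longrightarrow> length xs = n \<Longrightarrow> foldr (\<otimes>\<^bsub>R\<^esub>) xs \<one>\<^bsub>R\<^esub> = \<zero>\<^bsub>R\<^esub>"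
    by (auto simp: nilpotent_subrng_def)
  have fS: "f g \<in> ?S" if "g \<in> carrier G" for g
    using that generate_rng.zero generate_rng.incl[of "f g" "f ` supp f"] by (cases "f g = \<zero>\<^bsub>R\<^esub>") (auto simp: gr_supp_def)
  have Sc: "x \<in> carrier R" if "x \<in> ?S" for x
    using that by induction (use f coeff_closed supp_in_carrier in auto)
  have pc: "foldr (\<otimes>\<^bsub>R\<^esub>) xs \<one>\<^bsub>R\<^esub> \<in> carrier R" if "set xs \<subseteq> ?S" for xs
    using that Sc by (induction xs) auto
  have fc: "f [^]\<^bsub>RG\<^esub> m \<in> carrier RG" for m :: nat using f by simp
  \<comment> \<open>Descends from f^n to f^0 by moving one coefficient at a time into the list of
    right factors, with n factors in total. At m = 0 the product is zero by the choice of n; the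
    empty list gives f^n = 0.\<close>
  have key: "(f [^]\<^bsub>RG\<^esub> m) x \<otimes>\<^bsub>R\<^esub> foldr (\<otimes>\<^bsub>R\<^esub>) xs \<one>\<^bsub>R\<^esub> = \<zero>\<^bsub>R\<^esub>"
    if "x \<in> carrier G" "set xs \<subseteq> ?S" "m + length xs = n" for m x xs
    using that
  proof (induction m arbitrary: x xs)
    case 0
    then show ?case using n(2) by (simp add: one_coeff)
  next
    case (Suc m)
    let ?A = "supp (f [^]\<^bsub>RG\<^esub> m)" and ?p = "foldr (\<otimes>\<^bsub>R\<^esub>) xs \<one>\<^bsub>R\<^esub>"
    have A: "finite ?A" "?A \<subseteq> carrier G" using finite_supp[OF fc] supp_in_carrier by auto
    have c: "(f [^]\<^bsub>RG\<^esub> m) y \<in> carrier R" "f (inv\<^bsub>G\<^esub> y \<otimes>\<^bsub>G\<^esub> x) \<in> carrier R" if "y \<in> ?A" for y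
      using that A Suc.prems(1) coeff_closed[OF fc] coeff_closed[OF f] by auto
    have "(f [^]\<^bsub>RG\<^esub> Suc m) x \<otimes>\<^bsub>R\<^esub> ?p
        = (\<Oplus>\<^bsub>R\<^esub>y\<in>?A. (f [^]\<^bsub>RG\<^esub> m) y \<otimes>\<^bsub>R\<^esub> f (inv\<^bsub>G\<^esub> y \<otimes>\<^bsub>G\<^esub> x)) \<otimes>\<^bsub>R\<^esub> ?p"
      using mult_coeff[OF fc f Suc.prems(1) A(1) _ A(2)] by simp
    also have "\<dots> = (\<Oplus>\<^bsub>R\<^esub>y\<in>?A. (f [^]\<^bsub>RG\<^esub> m) y \<otimes>\<^bsub>R\<^esub> f (inv\<^bsub>G\<^esub> y \<otimes>\<^bsub>G\<^esub> x) \<otimes>\<^bsub>R\<^esub> ?p)"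
      by (rule R.finsum_ldistr) (use A c pc Suc.prems in auto)
    also have "\<dots> = \<zero>\<^bsub>R\<^esub>"
    proof (rule R.add.finprod_one_eqI[simplified])
      fix y assume y: "y \<in> ?A"
      have yG: "y \<in> carrier G" using y A by auto
      have "(f [^]\<^bsub>RG\<^esub> m) y \<otimes>\<^bsub>R\<^esub> foldr (\<otimes>\<^bsub>R\<^esub>) (f (inv\<^bsub>G\<^esub> y \<otimes>\<^bsub>G\<^esub> x) # xs) \<one>\<^bsub>R\<^esub> = \<zero>\<^bsub>R\<^esub>"
        by (rule Suc.IH) (use yG Suc.prems fS in auto)
      then show "(f [^]\<^bsub>RG\<^esub> m) y \<otimes>\<^bsub>R\<^esub> f (inv\<^bsub>G\<^esub> y \<otimes>\<^bsub>G\<^esub> x) \<otimes>\<^bsub>R\<^esub> ?p = \<zero>\<^bsub>R\<^esub>"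
        using c[OF y] pc Suc.prems by (simp add: R.m_assoc)
    qed
    finally show ?case .
  qed
  have "f [^]\<^bsub>RG\<^esub> n = \<zero>\<^bsub>RG\<^esub>"
    by (rule group_ring_eqI) (use fc key[of _ "[]" n] coeff_closed[OF fc] in \<open>auto simp: zero_coeff\<close>)
  then show ?thesis using f n(1) by (auto simp: nilpotent_def)
qed

end

section \<open>Group rings over strongly regular rings\<close>

context group_ring_setup
begin

text \<open>Solvability of both absorption equations modulo the ideal of elements with all
  coefficients in P. Stating it through coefficients keeps b and c in one fixed ring, so that
  different P can be compared.\<close>

definition absorbs_mod where
  "absorbs_mod a k P \<longleftrightarrow> (\<exists>b\<in>carrier RG. \<exists>c\<in>carrier RG. \<forall>g\<in>carrier G.
     (a [^]\<^bsub>RG\<^esub> k \<ominus>\<^bsub>RG\<^esub> a [^]\<^bsub>RG\<^esub> Suc k \<otimes>\<^bsub>RG\<^esub> b) g \<in> P \<and>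
     (a [^]\<^bsub>RG\<^esub> k \<ominus>\<^bsub>RG\<^esub> c \<otimes>\<^bsub>RG\<^esub> a [^]\<^bsub>RG\<^esub> Suc k) g \<in> P)"

text \<open>The two error terms have finitely many nonzero coefficients, and one member of the chain
  contains them all. Its contrapositive shows that bad ideals are closed under unions of
  chains.\<close>

lemma absorbs_mod_Union_chain:
  assumes a: "a \<in> carrier RG" and C: "C \<noteq> {}" "subset.chain {I. ideal I R} C"
    and U: "absorbs_mod a k (\<Union>C)"
  shows "\<exists>I\<in>C. absorbs_mod a k I"
proof -
  obtain b c where bc: "b \<in> carrier RG" "c \<in> carrier RG"
    and U': "\<And>g. g \<in> carrier G \<Longrightarrow>
      (a [^]\<^bsub>RG\<^esub> k \<ominus>\<^bsub>RG\<^esub> a [^]\<^bsub>RG\<^esub> Suc k \<otimes>\<^bsub>RG\<^esub> b) g \<in> \<Union>C \<and>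
      (a [^]\<^bsub>RG\<^esub> k \<ominus>\<^bsub>RG\<^esub> c \<otimes>\<^bsub>RG\<^esub> a [^]\<^bsub>RG\<^esub> Suc k) g \<in> \<Union>C"
    using U unfolding absorbs_mod_def by blast
  define x where "x = a [^]\<^bsub>RG\<^esub> k \<ominus>\<^bsub>RG\<^esub> a [^]\<^bsub>RG\<^esub> Suc k \<otimes>\<^bsub>RG\<^esub> b"
  define y where "y = a [^]\<^bsub>RG\<^esub> k \<ominus>\<^bsub>RG\<^esub> c \<otimes>\<^bsub>RG\<^esub> a [^]\<^bsub>RG\<^esub> Suc k"
  have xy: "x \<in> carrier RG" "y \<in> carrier RG" using a bc by (auto simp: x_def y_def)
  let ?F = "x ` supp x \<union> y ` supp y"
  have "finite ?F" using finite_supp xy by auto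
  moreover have "?F \<subseteq> \<Union>C" using U' supp_in_carrier unfolding x_def y_def by blast
  ultimately obtain I where I: "I \<in> C" "?F \<subseteq> I"
    using finite_subset_Union_chain[OF _ _ C] by metis
  have idl: "ideal I R" using I(1) C(2) by (auto simp: subset_chain_def)
  interpret I: ideal I R by fact
  have mem: "z g \<in> I" if "g \<in> carrier G" "z ` supp z \<subseteq> I" for z g
    using that I.zero_closed by (cases "z g = \<zero>\<^bsub>R\<^esub>") (auto simp: gr_supp_def)
  have "x g \<in> I" "y g \<in> I" if "g \<in> carrier G" for g
    using mem[OF that] I(2) by blast+
  then show ?thesis using I(1) bc unfolding absorbs_mod_def x_def y_def by blast
qed

text \<open>The quotient R/P is a division ring, so linear algebra applies over it with the same H.
  The multipliers found there are lifted along the surjection of group rings, and the errors of the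
  lifted equations have coefficients in P.\<close>

lemma absorbs_mod_quotient_division_ring:
  assumes P: "ideal P R" "\<one>\<^bsub>R\<^esub> \<notin> P"
    and inv: "\<And>s. s \<in> carrier R \<Longrightarrow> s \<notin> P \<Longrightarrow> \<exists>u\<in>Units R. \<one>\<^bsub>R\<^esub> \<ominus>\<^bsub>R\<^esub> u \<otimes>\<^bsub>R\<^esub> s \<in> P"
    and H: "subgroup H G" "finite H" and a: "a \<in> carrier RG" "supp a \<subseteq> H"
  shows "absorbs_mod a (card H) P"
proof -
  let ?k = "card H"
  let ?D = "R Quot P"
  interpret P: ideal P R by fact
  interpret \<pi>: ring_hom_ring R ?D "(+>) P" by (rule P.rcos_ring_hom_ring)
  interpret DG: group_ring_setup ?D G by unfold_locales
  interpret h: ring_hom_ring RG DG.RG "gr_map G ((+>) P)" by (rule \<pi>.gr_map_hom) unfold_locales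
  have zero: "P +> x = \<zero>\<^bsub>?D\<^esub> \<longleftrightarrow> x \<in> P" if "x \<in> carrier R" for x using P.rcos_zero_iff that .
  have nt: "\<one>\<^bsub>?D\<^esub> \<noteq> \<zero>\<^bsub>?D\<^esub>" using zero[OF R.one_closed] P(2) by simp
  \<comment> \<open>The hypothesis says u s = 1 modulo P, a one-sided relation; since u remains a
    unit in the quotient, x is its inverse.\<close>
  have div: "x \<in> Units ?D" if x: "x \<in> carrier ?D" "x \<noteq> \<zero>\<^bsub>?D\<^esub>" for x
  proof -
    obtain s where s: "s \<in> carrier R" "x = P +> s" using x(1) P.rcos_surj by blast
    have "s \<notin> P" using zero s x(2) by auto
    then obtain u where u: "u \<in> Units R" "\<one>\<^bsub>R\<^esub> \<ominus>\<^bsub>R\<^esub> u \<otimes>\<^bsub>R\<^esub> s \<in> P" using inv s(1) by blast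
    have uc: "u \<in> carrier R" using u(1) by auto
    have "P +> (\<one>\<^bsub>R\<^esub> \<ominus>\<^bsub>R\<^esub> u \<otimes>\<^bsub>R\<^esub> s) = \<zero>\<^bsub>?D\<^esub>" using u uc s(1) by (subst zero) auto
    then have "\<one>\<^bsub>?D\<^esub> \<ominus>\<^bsub>?D\<^esub> (P +> u) \<otimes>\<^bsub>?D\<^esub> x = \<zero>\<^bsub>?D\<^esub>"
      using uc s by (simp add: R.minus_eq \<pi>.S.minus_eq)
    then have e: "(P +> u) \<otimes>\<^bsub>?D\<^esub> x = \<one>\<^bsub>?D\<^esub>"
      using \<pi>.hom_closed[OF uc] x(1) by (simp add: \<pi>.S.r_right_minus_eq)
    have U: "P +> u \<in> Units ?D" using \<pi>.hom_Units[OF u(1)] .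
    have "x = inv\<^bsub>?D\<^esub> (P +> u) \<otimes>\<^bsub>?D\<^esub> ((P +> u) \<otimes>\<^bsub>?D\<^esub> x)"
      using U x(1) \<pi>.hom_closed[OF uc] by (simp add: \<pi>.S.m_assoc[symmetric])
    then have "x = inv\<^bsub>?D\<^esub> (P +> u)" using U unfolding e by simp
    then show ?thesis using U by simp
  qed
  have ha: "gr_map G ((+>) P) a \<in> carrier DG.RG" "DG.supp (gr_map G ((+>) P) a) \<subseteq> H"
    using h.hom_closed[OF a(1)] \<pi>.gr_map_supp[OF a(1)] a(2) by auto
  have surj: "gr_map G ((+>) P) ` carrier RG = carrier DG.RG"
    by (rule \<pi>.gr_map_surj[OF _ P.rcos_surj]) unfold_locales
  let ?h = "gr_map G ((+>) P)"
  have pow: "?h (a [^]\<^bsub>RG\<^esub> n) = ?h a [^]\<^bsub>DG.RG\<^esub> n" for n :: nat using h.hom_nat_pow[OF a(1)] .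
  have pc: "a [^]\<^bsub>RG\<^esub> n \<in> carrier RG" for n :: nat using a by simp
  obtain b' where b': "b' \<in> carrier DG.RG"
    "?h a [^]\<^bsub>DG.RG\<^esub> ?k = ?h a [^]\<^bsub>DG.RG\<^esub> Suc ?k \<otimes>\<^bsub>DG.RG\<^esub> b'"
    using DG.division_ring_power_right_absorb[OF div nt H ha] by blast
  obtain c' where c': "c' \<in> carrier DG.RG"
    "?h a [^]\<^bsub>DG.RG\<^esub> ?k = c' \<otimes>\<^bsub>DG.RG\<^esub> ?h a [^]\<^bsub>DG.RG\<^esub> Suc ?k"
    using DG.division_ring_power_left_absorb[OF div nt H ha] by blast
  have "b' \<in> ?h ` carrier RG" "c' \<in> ?h ` carrier RG" unfolding surj by fact+
  then obtain b c where b: "b \<in> carrier RG" "b' = ?h b" and c: "c \<in> carrier RG" "c' = ?h c" by blast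
  have diff: "x g \<in> P" if "x \<in> carrier RG" "?h x = \<zero>\<^bsub>DG.RG\<^esub>" "g \<in> carrier G" for x g
    using gr_map_eq_zero[OF that(2,3)] zero coeff_closed that by auto
  have eq: "?h (x \<ominus>\<^bsub>RG\<^esub> y) = \<zero>\<^bsub>DG.RG\<^esub>" if "x \<in> carrier RG" "y \<in> carrier RG" "?h x = ?h y" for x y
    using that by (simp add: RG.minus_eq DG.RG.r_neg)
  have "?h (a [^]\<^bsub>RG\<^esub> ?k) = ?h (a [^]\<^bsub>RG\<^esub> Suc ?k \<otimes>\<^bsub>RG\<^esub> b)"
    unfolding h.hom_mult[OF pc b(1)] pow b(2)[symmetric] by (rule b'(2))
  moreover have "?h (a [^]\<^bsub>RG\<^esub> ?k) = ?h (c \<otimes>\<^bsub>RG\<^esub> a [^]\<^bsub>RG\<^esub> Suc ?k)"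
    unfolding h.hom_mult[OF c(1) pc] pow c(2)[symmetric] by (rule c'(2))
  ultimately show ?thesis
    unfolding absorbs_mod_def using b(1) c(1) pc
    by (intro bexI[of _ b] bexI[of _ c] ballI conjI diff eq RG.minus_closed RG.m_closed)
qed

text \<open>Gluing: take b = e b1 + f b2 and c = e c1 + f c2. As e and f are central with sum 1,
  they pass through the powers of a, and the error is e times the first error plus f times the
  second.\<close>

lemma absorbs_mod_colon:
  assumes P: "ideal P R" and e: "e \<in> carrier R" "\<And>r. r \<in> carrier R \<Longrightarrow> e \<otimes>\<^bsub>R\<^esub> r = r \<otimes>\<^bsub>R\<^esub> e"
    and f: "f \<in> carrier R" "\<And>r. r \<in> carrier R \<Longrightarrow> f \<otimes>\<^bsub>R\<^esub> r = r \<otimes>\<^bsub>R\<^esub> f" and ef: "e \<oplus>\<^bsub>R\<^esub> f = \<one>\<^bsub>R\<^esub>"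
    and a: "a \<in> carrier RG"
    and 1: "absorbs_mod a k {x \<in> carrier R. e \<otimes>\<^bsub>R\<^esub> x \<in> P}"
    and 2: "absorbs_mod a k {x \<in> carrier R. f \<otimes>\<^bsub>R\<^esub> x \<in> P}"
  shows "absorbs_mod a k P"
proof -
  interpret P: ideal P R by fact
  let ?E = "gr_const R G e" and ?F = "gr_const R G f"
  let ?p = "a [^]\<^bsub>RG\<^esub> k" and ?q = "a [^]\<^bsub>RG\<^esub> Suc k"
  have p: "?p \<in> carrier RG" and q: "?q \<in> carrier RG" using a by (auto simp del: Group.nat_pow_Suc RG.nat_pow_Suc)
  have E: "?E \<in> carrier RG" and F: "?F \<in> carrier RG" using const_in e f by auto
  have EF: "?E \<oplus>\<^bsub>RG\<^esub> ?F = \<one>\<^bsub>RG\<^esub>"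
    by (rule group_ring_eqI) (use E F e f ef in \<open>auto simp: add_coeff one_coeff gr_const_def\<close>)
  have comb: "p' \<ominus>\<^bsub>RG\<^esub> (?E \<otimes>\<^bsub>RG\<^esub> x \<oplus>\<^bsub>RG\<^esub> ?F \<otimes>\<^bsub>RG\<^esub> y)
      = ?E \<otimes>\<^bsub>RG\<^esub> (p' \<ominus>\<^bsub>RG\<^esub> x) \<oplus>\<^bsub>RG\<^esub> ?F \<otimes>\<^bsub>RG\<^esub> (p' \<ominus>\<^bsub>RG\<^esub> y)"
    if c: "p' \<in> carrier RG" "x \<in> carrier RG" "y \<in> carrier RG" for p' x y
  proof -
    have "p' = ?E \<otimes>\<^bsub>RG\<^esub> p' \<oplus>\<^bsub>RG\<^esub> ?F \<otimes>\<^bsub>RG\<^esub> p'"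
      using E F c EF by (simp add: RG.l_distr[symmetric])
    then have "p' \<ominus>\<^bsub>RG\<^esub> (?E \<otimes>\<^bsub>RG\<^esub> x \<oplus>\<^bsub>RG\<^esub> ?F \<otimes>\<^bsub>RG\<^esub> y)
        = (?E \<otimes>\<^bsub>RG\<^esub> p' \<oplus>\<^bsub>RG\<^esub> ?F \<otimes>\<^bsub>RG\<^esub> p') \<ominus>\<^bsub>RG\<^esub> (?E \<otimes>\<^bsub>RG\<^esub> x \<oplus>\<^bsub>RG\<^esub> ?F \<otimes>\<^bsub>RG\<^esub> y)" by simp
    then show ?thesis
      using E F c by (simp add: RG.minus_eq RG.r_distr RG.r_minus RG.minus_add RG.a_ac)
  qed
  have mem: "(?E \<otimes>\<^bsub>RG\<^esub> x \<oplus>\<^bsub>RG\<^esub> ?F \<otimes>\<^bsub>RG\<^esub> y) g \<in> P"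
    if "x \<in> carrier RG" "y \<in> carrier RG" "g \<in> carrier G" "e \<otimes>\<^bsub>R\<^esub> x g \<in> P" "f \<otimes>\<^bsub>R\<^esub> y g \<in> P" for x y g
    using that e f P.a_closed by (simp add: add_coeff const_mult_coeff)
  obtain b1 c1 where bc1: "b1 \<in> carrier RG" "c1 \<in> carrier RG"
    and m1: "\<And>g. g \<in> carrier G \<Longrightarrow> e \<otimes>\<^bsub>R\<^esub> (?p \<ominus>\<^bsub>RG\<^esub> ?q \<otimes>\<^bsub>RG\<^esub> b1) g \<in> P"
      "\<And>g. g \<in> carrier G \<Longrightarrow> e \<otimes>\<^bsub>R\<^esub> (?p \<ominus>\<^bsub>RG\<^esub> c1 \<otimes>\<^bsub>RG\<^esub> ?q) g \<in> P"
    using 1 unfolding absorbs_mod_def by blast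
  obtain b2 c2 where bc2: "b2 \<in> carrier RG" "c2 \<in> carrier RG"
    and m2: "\<And>g. g \<in> carrier G \<Longrightarrow> f \<otimes>\<^bsub>R\<^esub> (?p \<ominus>\<^bsub>RG\<^esub> ?q \<otimes>\<^bsub>RG\<^esub> b2) g \<in> P"
      "\<And>g. g \<in> carrier G \<Longrightarrow> f \<otimes>\<^bsub>R\<^esub> (?p \<ominus>\<^bsub>RG\<^esub> c2 \<otimes>\<^bsub>RG\<^esub> ?q) g \<in> P"
    using 2 unfolding absorbs_mod_def by blast
  let ?b = "?E \<otimes>\<^bsub>RG\<^esub> b1 \<oplus>\<^bsub>RG\<^esub> ?F \<otimes>\<^bsub>RG\<^esub> b2" and ?c = "?E \<otimes>\<^bsub>RG\<^esub> c1 \<oplus>\<^bsub>RG\<^esub> ?F \<otimes>\<^bsub>RG\<^esub> c2"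
  have Eq: "?q \<otimes>\<^bsub>RG\<^esub> ?E = ?E \<otimes>\<^bsub>RG\<^esub> ?q" and Fq: "?q \<otimes>\<^bsub>RG\<^esub> ?F = ?F \<otimes>\<^bsub>RG\<^esub> ?q"
    using const_central[OF e q] const_central[OF f q] by simp_all
  have qb: "?q \<otimes>\<^bsub>RG\<^esub> ?b = ?E \<otimes>\<^bsub>RG\<^esub> (?q \<otimes>\<^bsub>RG\<^esub> b1) \<oplus>\<^bsub>RG\<^esub> ?F \<otimes>\<^bsub>RG\<^esub> (?q \<otimes>\<^bsub>RG\<^esub> b2)"
  proof -
    have "?q \<otimes>\<^bsub>RG\<^esub> ?b = ?q \<otimes>\<^bsub>RG\<^esub> ?E \<otimes>\<^bsub>RG\<^esub> b1 \<oplus>\<^bsub>RG\<^esub> ?q \<otimes>\<^bsub>RG\<^esub> ?F \<otimes>\<^bsub>RG\<^esub> b2"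
      using E F q bc1 bc2 by (simp add: RG.r_distr RG.m_assoc del: Group.nat_pow_Suc RG.nat_pow_Suc)
    then show ?thesis unfolding Eq Fq
      using E F q bc1 bc2 by (simp add: RG.m_assoc del: Group.nat_pow_Suc RG.nat_pow_Suc)
  qed
  have cq: "?c \<otimes>\<^bsub>RG\<^esub> ?q = ?E \<otimes>\<^bsub>RG\<^esub> (c1 \<otimes>\<^bsub>RG\<^esub> ?q) \<oplus>\<^bsub>RG\<^esub> ?F \<otimes>\<^bsub>RG\<^esub> (c2 \<otimes>\<^bsub>RG\<^esub> ?q)"
    using E F q bc1 bc2 by (simp add: RG.l_distr RG.m_assoc del: Group.nat_pow_Suc RG.nat_pow_Suc)
  have "(?p \<ominus>\<^bsub>RG\<^esub> ?q \<otimes>\<^bsub>RG\<^esub> ?b) g \<in> P \<and> (?p \<ominus>\<^bsub>RG\<^esub> ?c \<otimes>\<^bsub>RG\<^esub> ?q) g \<in> P" if g: "g \<in> carrier G" for g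
  proof
    show "(?p \<ominus>\<^bsub>RG\<^esub> ?q \<otimes>\<^bsub>RG\<^esub> ?b) g \<in> P"
      unfolding qb by (subst comb; (rule mem)?)
        (intro p q bc1 bc2 g m1 m2 RG.m_closed RG.minus_closed)+
    show "(?p \<ominus>\<^bsub>RG\<^esub> ?c \<otimes>\<^bsub>RG\<^esub> ?q) g \<in> P"
      unfolding cq by (subst comb; (rule mem)?)
        (intro p q bc1 bc2 g m1 m2 RG.m_closed RG.minus_closed)+
  qed
  moreover have "?b \<in> carrier RG" "?c \<in> carrier RG" using E F bc1 bc2 by simp_all
  ultimately show ?thesis unfolding absorbs_mod_def by (intro bexI[of _ ?b] bexI[of _ ?c] ballI)
qed

text \<open>An ideal maximal among those modulo which the claim fails would have a division ring
  as quotient, because the colon ideals of the idempotents \<open>e\<close> and \<open>1 - e\<close> are larger.\<close>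

lemma strongly_regular_power_absorb:
  assumes red: "\<And>x. nilpotent R x \<Longrightarrow> x = \<zero>\<^bsub>R\<^esub>" and sunc: "strongly_unit_nil_clean R"
    and H: "subgroup H G" "finite H" and a: "a \<in> carrier RG" "supp a \<subseteq> H"
  shows "\<exists>b\<in>carrier RG. \<exists>c\<in>carrier RG.
     a [^]\<^bsub>RG\<^esub> card H = a [^]\<^bsub>RG\<^esub> Suc (card H) \<otimes>\<^bsub>RG\<^esub> b \<and>
     a [^]\<^bsub>RG\<^esub> card H = c \<otimes>\<^bsub>RG\<^esub> a [^]\<^bsub>RG\<^esub> Suc (card H)"
proof -
  let ?k = "card H"
  let ?A = "{I. ideal I R \<and> \<not> absorbs_mod a ?k I}"
  have pc: "a [^]\<^bsub>RG\<^esub> n \<in> carrier RG" for n :: nat using a by simp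
  have "absorbs_mod a ?k {\<zero>\<^bsub>R\<^esub>}"
  proof (rule ccontr)
    assume "\<not> absorbs_mod a ?k {\<zero>\<^bsub>R\<^esub>}"
    then have "?A \<noteq> {}" using R.zeroideal by blast
    moreover have "\<Union>C \<in> ?A" if C: "C \<noteq> {}" "subset.chain ?A C" for C
    proof -
      have ch: "subset.chain {I. ideal I R} C" using C(2) by (auto simp: subset_chain_def)
      have "ideal (\<Union>C) R" using R.chain_Union_is_ideal[OF ch] C(1) by simp
      moreover have "\<not> absorbs_mod a ?k (\<Union>C)"
        using absorbs_mod_Union_chain[OF a(1) C(1) ch] C(2) by (auto simp: subset_chain_def)
      ultimately show ?thesis by simp
    qed
    ultimately have "\<exists>M\<in>?A. \<forall>I\<in>?A. M \<subseteq> I \<longrightarrow> I = M" by (rule subset_Zorn_nonempty)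
    then obtain P where PA: "P \<in> ?A" and max: "\<And>I. I \<in> ?A \<Longrightarrow> P \<subseteq> I \<Longrightarrow> I = P" by meson
    have idl: "ideal P R" and nP: "\<not> absorbs_mod a ?k P" using PA by auto
    interpret P: ideal P R by fact
    have P1: "\<one>\<^bsub>R\<^esub> \<notin> P"
    proof
      assume "\<one>\<^bsub>R\<^esub> \<in> P"
      then have "P = carrier R" by (rule P.one_imp_carrier)
      \<comment> \<open>If P is all of R the membership conditions are void, and zero serves as both
        multipliers.\<close>
      then have "absorbs_mod a ?k P"
        unfolding absorbs_mod_def using pc coeff_closed
        by (intro bexI[of _ "\<zero>\<^bsub>RG\<^esub>"]) (auto simp del: Group.nat_pow_Suc RG.nat_pow_Suc)
      then show False using nP by simp
    qed
    have "absorbs_mod a ?k P"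
    proof (rule absorbs_mod_quotient_division_ring[OF idl P1 _ H a])
      fix s assume s: "s \<in> carrier R" "s \<notin> P"
      obtain u where u: "u \<in> Units R" "strongly_nil_clean R (u \<otimes>\<^bsub>R\<^esub> s)"
        using sunc s(1) by (auto simp: strongly_unit_nil_clean_def)
      obtain e b where eb: "e \<in> carrier R" "e \<otimes>\<^bsub>R\<^esub> e = e" "nilpotent R b" "u \<otimes>\<^bsub>R\<^esub> s = e \<oplus>\<^bsub>R\<^esub> b"
        using u(2) unfolding strongly_nil_clean_def by blast
      \<comment> \<open>In a reduced ring the nilpotent summand b is zero.\<close>
      have us: "u \<otimes>\<^bsub>R\<^esub> s = e" using red[OF eb(3)] eb(1,4) by simp
      have central: "e \<otimes>\<^bsub>R\<^esub> r = r \<otimes>\<^bsub>R\<^esub> e" if "r \<in> carrier R" for r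
        by (rule R.reduced_idempotent_central[OF red eb(1,2) that])
      define f where "f = \<one>\<^bsub>R\<^esub> \<ominus>\<^bsub>R\<^esub> e"
      have f: "f \<in> carrier R" "e \<oplus>\<^bsub>R\<^esub> f = \<one>\<^bsub>R\<^esub>" "e \<otimes>\<^bsub>R\<^esub> f = \<zero>\<^bsub>R\<^esub>" "f \<otimes>\<^bsub>R\<^esub> e = \<zero>\<^bsub>R\<^esub>"
        using eb(1,2) by (simp_all add: f_def R.minus_eq R.a_comm[of "\<one>\<^bsub>R\<^esub>"] R.r_neg2
            R.l_distr R.r_distr R.l_minus R.r_minus R.l_neg)
      have fcentral: "f \<otimes>\<^bsub>R\<^esub> r = r \<otimes>\<^bsub>R\<^esub> f" if "r \<in> carrier R" for r
        using that eb(1) central[OF that]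
        by (simp add: f_def R.minus_eq R.l_distr R.r_distr R.l_minus R.r_minus)
      have eP: "e \<notin> P"
      proof
        assume "e \<in> P"
        then have "inv\<^bsub>R\<^esub> u \<otimes>\<^bsub>R\<^esub> (u \<otimes>\<^bsub>R\<^esub> s) \<in> P" using us u(1) P.I_l_closed by simp
        then show False using s u(1) by (simp add: R.m_assoc[symmetric] R.Units_closed)
      qed
      have "f \<in> P"
      proof (rule ccontr)
        assume fP: "f \<notin> P"
        \<comment> \<open>The colon ideal of c contains P and also d, which is outside P; by
          maximality of P it is not bad. Applied to the pairs (e, f) and (f, e).\<close>
        have larger: "absorbs_mod a ?k {x \<in> carrier R. c \<otimes>\<^bsub>R\<^esub> x \<in> P}"
          if "c \<in> carrier R" "\<And>r. r \<in> carrier R \<Longrightarrow> c \<otimes>\<^bsub>R\<^esub> r = r \<otimes>\<^bsub>R\<^esub> c"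
            "d \<in> carrier R" "c \<otimes>\<^bsub>R\<^esub> d = \<zero>\<^bsub>R\<^esub>" "d \<notin> P" for c d
        proof (rule ccontr)
          let ?I = "{x \<in> carrier R. c \<otimes>\<^bsub>R\<^esub> x \<in> P}"
          assume "\<not> absorbs_mod a ?k ?I"
          moreover have "ideal ?I R" by (rule R.central_colon_ideal[OF idl that(1,2)])
          moreover have "P \<subseteq> ?I" using P.I_l_closed that(1) P.Icarr by auto
          ultimately have "?I = P" using max[of ?I] by simp
          moreover have "d \<in> ?I" using that P.zero_closed by simp
          ultimately show False using that(5) by simp
        qed
        have "absorbs_mod a ?k P"
          by (rule absorbs_mod_colon[OF idl eb(1) central f(1) fcentral f(2) a(1)
                larger[OF eb(1) central f(1) f(3) fP] larger[OF f(1) fcentral eb(1) f(4) eP]])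
        then show False using nP by simp
      qed
      then show "\<exists>u\<in>Units R. \<one>\<^bsub>R\<^esub> \<ominus>\<^bsub>R\<^esub> u \<otimes>\<^bsub>R\<^esub> s \<in> P"
        using u(1) us by (auto simp: f_def)
    qed
    then show False using nP by simp
  qed
  then obtain b c where bc: "b \<in> carrier RG" "c \<in> carrier RG"
    and z: "\<And>g. g \<in> carrier G \<Longrightarrow> (a [^]\<^bsub>RG\<^esub> ?k \<ominus>\<^bsub>RG\<^esub> a [^]\<^bsub>RG\<^esub> Suc ?k \<otimes>\<^bsub>RG\<^esub> b) g = \<zero>\<^bsub>R\<^esub>"
      "\<And>g. g \<in> carrier G \<Longrightarrow> (a [^]\<^bsub>RG\<^esub> ?k \<ominus>\<^bsub>RG\<^esub> c \<otimes>\<^bsub>RG\<^esub> a [^]\<^bsub>RG\<^esub> Suc ?k) g = \<zero>\<^bsub>R\<^esub>"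
    unfolding absorbs_mod_def by blast
  have eq: "x = y" if "x \<in> carrier RG" "y \<in> carrier RG"
    "\<And>g. g \<in> carrier G \<Longrightarrow> (x \<ominus>\<^bsub>RG\<^esub> y) g = \<zero>\<^bsub>R\<^esub>" for x y
  proof -
    have "x \<ominus>\<^bsub>RG\<^esub> y = \<zero>\<^bsub>RG\<^esub>"
      by (rule group_ring_eqI) (use that in \<open>auto simp: zero_coeff\<close>)
    then show ?thesis using that by simp
  qed
  show ?thesis using bc pc z
    by (intro bexI[of _ b] bexI[of _ c] conjI eq RG.m_closed)
qed

end

section \<open>Locally finite groups over weakly 2-primal rings\<close>

lemma strongly_unit_nil_clean_group_ring:
  assumes "ring R" "group G" and w: "weakly_2_primal R" and sunc: "strongly_unit_nil_clean R"
    and lf: "locally_finite_group G"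
  shows "strongly_unit_nil_clean (group_ring R G)"
  unfolding strongly_unit_nil_clean_def
proof
  interpret R: ring R by fact
  interpret G: group G by fact
  interpret RG: group_ring_setup R G by unfold_locales
  let ?N = "nilpotents R"
  have N: "ideal ?N R" "locally_nilpotent R ?N"
    using w by (auto simp: weakly_2_primal_def is_levitzki_radical_def)
  interpret N: ideal ?N R by fact
  let ?S = "R Quot ?N"
  interpret \<pi>: ring_hom_ring R ?S "(+>\<^bsub>R\<^esub>) ?N" by (rule N.rcos_ring_hom_ring)
  interpret SG: group_ring_setup ?S G by unfold_locales
  interpret h: ring_hom_ring RG.RG SG.RG "gr_map G ((+>\<^bsub>R\<^esub>) ?N)" by (rule \<pi>.gr_map_hom) unfold_locales
  let ?h = "gr_map G ((+>\<^bsub>R\<^esub>) ?N)"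
  have surj: "?h ` carrier RG.RG = carrier SG.RG"
    by (rule \<pi>.gr_map_surj[OF _ N.rcos_surj]) unfold_locales
  have nil: "nilpotent RG.RG x" if x: "x \<in> carrier RG.RG" "?h x = \<zero>\<^bsub>SG.RG\<^esub>" for x
  proof (rule RG.nilpotent_if_coeffs_locally_nilpotent[OF N(2) x(1)])
    fix g assume g: "g \<in> carrier G"
    show "x g \<in> ?N"
      using gr_map_eq_zero[OF x(2) g] N.rcos_zero_iff[OF RG.coeff_closed[OF x(1) g]] by simp
  qed
  fix a assume a: "a \<in> carrier RG.RG"
  define H where "H = generate G (RG.supp a)"
  have sub: "RG.supp a \<subseteq> carrier G" using RG.supp_in_carrier by auto
  have H: "subgroup H G" "finite H"
    using G.generate_is_subgroup[OF sub] lf RG.finite_supp[OF a] sub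
    by (auto simp: H_def locally_finite_group_def)
  \<comment> \<open>H contains the identity even when a = 0; the Fitting decomposition needs a
    positive exponent.\<close>
  have k: "card H > 0" using H subgroup.one_closed[OF H(1)] by (auto simp: card_gt_0_iff)
  have ha: "?h a \<in> carrier SG.RG" "SG.supp (?h a) \<subseteq> H"
    using h.hom_closed[OF a] \<pi>.gr_map_supp[OF a] generate.incl[of _ "RG.supp a" G] by (auto simp: H_def)
  obtain b c where bc: "b \<in> carrier SG.RG" "c \<in> carrier SG.RG"
    "?h a [^]\<^bsub>SG.RG\<^esub> card H = ?h a [^]\<^bsub>SG.RG\<^esub> Suc (card H) \<otimes>\<^bsub>SG.RG\<^esub> b"
    "?h a [^]\<^bsub>SG.RG\<^esub> card H = c \<otimes>\<^bsub>SG.RG\<^esub> ?h a [^]\<^bsub>SG.RG\<^esub> Suc (card H)"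
    using SG.strongly_regular_power_absorb[OF R.weakly_2_primal_quotient_reduced[OF N(1)]
        \<pi>.surj_strongly_unit_nil_clean[OF N.rcos_surj sunc] H ha] by blast
  obtain u where "u \<in> Units SG.RG" "strongly_nil_clean SG.RG (u \<otimes>\<^bsub>SG.RG\<^esub> ?h a)"
    using SG.RG.strongly_nil_clean_multiple_if_strongly_pi_regular[OF ha(1) bc(1,2) k bc(3,4)] by blast
  then show "\<exists>u\<in>Units RG.RG. strongly_nil_clean RG.RG (u \<otimes>\<^bsub>RG.RG\<^esub> a)"
    using h.strongly_nil_clean_multiple_lift[OF surj nil a] by blast
qed

section \<open>Augmentation and torsion\<close>

text \<open>Summation is over the support because \<open>finsum\<close> over an infinite set is zero
  by convention. Supports of different elements differ, so \<open>augmentation_eq\<close> permits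
  any finite superset.\<close>

definition gr_augmentation :: "('a, 'm) ring_scheme \<Rightarrow> ('g, 'n) monoid_scheme \<Rightarrow> ('g \<Rightarrow> 'a) \<Rightarrow> 'a" where
  "gr_augmentation R G f = finsum R f (gr_supp R G f)"

definition gr_basis :: "('a, 'm) ring_scheme \<Rightarrow> ('g, 'n) monoid_scheme \<Rightarrow> 'g \<Rightarrow> 'g \<Rightarrow> 'a" where
  "gr_basis R G g = (\<lambda>x\<in>carrier G. if x = g then \<one>\<^bsub>R\<^esub> else \<zero>\<^bsub>R\<^esub>)"

context group_ring_setup
begin

lemma augmentation_eq:
  assumes "f \<in> carrier RG" "finite A" "supp f \<subseteq> A" "A \<subseteq> carrier G"
  shows "gr_augmentation R G f = (\<Oplus>\<^bsub>R\<^esub>y\<in>A. f y)"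
  unfolding gr_augmentation_def
proof (rule R.add.finprod_mono_neutral_cong_left[OF assms(2,3)])
  fix i assume "i \<in> A - supp f"
  then show "f i = \<zero>\<^bsub>R\<^esub>" using assms(4) by (auto simp: gr_supp_def)
qed (use assms coeff_closed in auto)

lemma augmentation_closed: "f \<in> carrier RG \<Longrightarrow> gr_augmentation R G f \<in> carrier R"
  unfolding gr_augmentation_def using coeff_closed supp_in_carrier by (intro R.finsum_closed) auto

lemma augmentation_singleton:
  assumes "g \<in> carrier G" "d \<in> carrier R"
    "f \<in> carrier RG" "\<And>x. x \<in> carrier G \<Longrightarrow> f x = (if x = g then d else \<zero>\<^bsub>R\<^esub>)"
  shows "gr_augmentation R G f = d"
proof -
  have "gr_augmentation R G f = (\<Oplus>\<^bsub>R\<^esub>y\<in>{g}. f y)"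
    using assms by (intro augmentation_eq) (auto simp: gr_supp_def split: if_splits)
  then show ?thesis using assms by simp
qed

lemma augmentation_hom: "ring_hom_ring RG R (gr_augmentation R G)"
proof (rule ring_hom_ringI[OF ring_RG R.ring_axioms])
  fix f k assume f: "f \<in> carrier RG" and k: "k \<in> carrier RG"
  have sc: "supp h \<subseteq> carrier G" for h using supp_in_carrier by auto
  show "gr_augmentation R G (f \<oplus>\<^bsub>RG\<^esub> k) = gr_augmentation R G f \<oplus>\<^bsub>R\<^esub> gr_augmentation R G k"
  proof -
    let ?A = "supp f \<union> supp k"
    have A: "finite ?A" "?A \<subseteq> carrier G" using finite_supp f k sc by auto
    have "gr_augmentation R G (f \<oplus>\<^bsub>RG\<^esub> k) = (\<Oplus>\<^bsub>R\<^esub>y\<in>?A. (f \<oplus>\<^bsub>RG\<^esub> k) y)"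
      using f k A by (intro augmentation_eq add_in) (auto simp: gr_supp_def add_coeff)
    also have "\<dots> = (\<Oplus>\<^bsub>R\<^esub>y\<in>?A. f y \<oplus>\<^bsub>R\<^esub> k y)"
      by (rule R.finsum_cong') (use A f k coeff_closed in \<open>auto simp: add_coeff subset_iff\<close>)
    also have "\<dots> = (\<Oplus>\<^bsub>R\<^esub>y\<in>?A. f y) \<oplus>\<^bsub>R\<^esub> (\<Oplus>\<^bsub>R\<^esub>y\<in>?A. k y)"
      by (rule R.finsum_addf) (use A f k coeff_closed in \<open>auto simp: subset_iff\<close>)
    finally show ?thesis using augmentation_eq[of f ?A] augmentation_eq[of k ?A] f k A by simp
  qed
  show "gr_augmentation R G (f \<otimes>\<^bsub>RG\<^esub> k) = gr_augmentation R G f \<otimes>\<^bsub>R\<^esub> gr_augmentation R G k"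
  proof -
    let ?A = "supp f"
    \<comment> \<open>For y in the support of f, the translate of B by the inverse of y covers the
      support of k. The inner sum is then the augmentation of k, independently of y.\<close>
    define B where "B = (\<lambda>(y,z). y \<otimes>\<^bsub>G\<^esub> z) ` (supp f \<times> supp k) \<union> supp (f \<otimes>\<^bsub>RG\<^esub> k)"
    have A: "finite ?A" "?A \<subseteq> carrier G" using finite_supp f sc by auto
    have B: "finite B" "B \<subseteq> carrier G" "supp (f \<otimes>\<^bsub>RG\<^esub> k) \<subseteq> B"
      using finite_supp f k mult_in sc by (auto simp: B_def dest: supp_in_carrier)
    have inner: "(\<Oplus>\<^bsub>R\<^esub>x\<in>B. k (inv\<^bsub>G\<^esub> y \<otimes>\<^bsub>G\<^esub> x)) = gr_augmentation R G k" if y: "y \<in> ?A" for y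
    proof -
      have yc: "y \<in> carrier G" using y A by auto
      have inj: "inj_on ((\<otimes>\<^bsub>G\<^esub>) (inv\<^bsub>G\<^esub> y)) B" using yc B by (meson G.inj_on_cmult G.inv_closed inj_on_subset)
      have "supp k \<subseteq> (\<otimes>\<^bsub>G\<^esub>) (inv\<^bsub>G\<^esub> y) ` B"
      proof
        fix z assume z: "z \<in> supp k"
        have zc: "z \<in> carrier G" using z sc by auto
        have "z = inv\<^bsub>G\<^esub> y \<otimes>\<^bsub>G\<^esub> (y \<otimes>\<^bsub>G\<^esub> z)" using yc zc by (simp add: G.m_assoc[symmetric])
        moreover have "y \<otimes>\<^bsub>G\<^esub> z \<in> B" using y z by (auto simp: B_def)
        ultimately show "z \<in> (\<otimes>\<^bsub>G\<^esub>) (inv\<^bsub>G\<^esub> y) ` B" by (rule image_eqI)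
      qed
      then have "gr_augmentation R G k = (\<Oplus>\<^bsub>R\<^esub>z\<in>(\<otimes>\<^bsub>G\<^esub>) (inv\<^bsub>G\<^esub> y) ` B. k z)"
        using k B yc by (intro augmentation_eq) auto
      also have "\<dots> = (\<Oplus>\<^bsub>R\<^esub>x\<in>B. k (inv\<^bsub>G\<^esub> y \<otimes>\<^bsub>G\<^esub> x))"
        by (rule R.finsum_reindex[OF _ inj]) (use k B yc coeff_closed in \<open>auto simp: subset_iff\<close>)
      finally show ?thesis by simp
    qed
    have c: "f y \<in> carrier R" "k (inv\<^bsub>G\<^esub> y \<otimes>\<^bsub>G\<^esub> x) \<in> carrier R" if "y \<in> ?A" "x \<in> B" for x y
      using that A B f k coeff_closed by (auto simp: subset_iff)
    have "gr_augmentation R G (f \<otimes>\<^bsub>RG\<^esub> k) = (\<Oplus>\<^bsub>R\<^esub>x\<in>B. (f \<otimes>\<^bsub>RG\<^esub> k) x)"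
      using f k B mult_in by (intro augmentation_eq) auto
    also have "\<dots> = (\<Oplus>\<^bsub>R\<^esub>x\<in>B. \<Oplus>\<^bsub>R\<^esub>y\<in>?A. f y \<otimes>\<^bsub>R\<^esub> k (inv\<^bsub>G\<^esub> y \<otimes>\<^bsub>G\<^esub> x))"
      by (rule R.finsum_cong') (use A B f k c in \<open>auto intro!: R.finsum_closed mult_coeff\<close>)
    also have "\<dots> = (\<Oplus>\<^bsub>R\<^esub>y\<in>?A. \<Oplus>\<^bsub>R\<^esub>x\<in>B. f y \<otimes>\<^bsub>R\<^esub> k (inv\<^bsub>G\<^esub> y \<otimes>\<^bsub>G\<^esub> x))"
      by (rule R.finsum_swap) (use A B c in auto)
    also have "\<dots> = (\<Oplus>\<^bsub>R\<^esub>y\<in>?A. f y \<otimes>\<^bsub>R\<^esub> gr_augmentation R G k)"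
    proof (rule R.finsum_cong')
      fix y assume y: "y \<in> ?A"
      have yc: "y \<in> carrier G" using y A by auto
      have "(\<Oplus>\<^bsub>R\<^esub>x\<in>B. f y \<otimes>\<^bsub>R\<^esub> k (inv\<^bsub>G\<^esub> y \<otimes>\<^bsub>G\<^esub> x)) = f y \<otimes>\<^bsub>R\<^esub> (\<Oplus>\<^bsub>R\<^esub>x\<in>B. k (inv\<^bsub>G\<^esub> y \<otimes>\<^bsub>G\<^esub> x))"
        by (rule R.finsum_rdistr[symmetric]) (use B c y coeff_closed[OF f yc] in auto)
      then show "(\<Oplus>\<^bsub>R\<^esub>x\<in>B. f y \<otimes>\<^bsub>R\<^esub> k (inv\<^bsub>G\<^esub> y \<otimes>\<^bsub>G\<^esub> x)) = f y \<otimes>\<^bsub>R\<^esub> gr_augmentation R G k"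
        unfolding inner[OF y] .
    qed (use A f k coeff_closed augmentation_closed in auto)
    also have "\<dots> = gr_augmentation R G f \<otimes>\<^bsub>R\<^esub> gr_augmentation R G k"
      unfolding gr_augmentation_def[of R G f]
      by (rule R.finsum_ldistr[symmetric]) (use A f k coeff_closed augmentation_closed in auto)
    finally show ?thesis .
  qed
next
  show "gr_augmentation R G \<one>\<^bsub>RG\<^esub> = \<one>\<^bsub>R\<^esub>"
    by (rule augmentation_singleton[of "\<one>\<^bsub>G\<^esub>"]) (auto simp: one_coeff)
qed (rule augmentation_closed)

lemma augmentation_surj: "gr_augmentation R G ` carrier RG = carrier R"
proof
  show "carrier R \<subseteq> gr_augmentation R G ` carrier RG"
  proof
    fix d assume d: "d \<in> carrier R"
    have "gr_augmentation R G (gr_const R G d) = d"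
      by (rule augmentation_singleton[of "\<one>\<^bsub>G\<^esub>"]) (use d const_in in \<open>auto simp: gr_const_def\<close>)
    then show "d \<in> gr_augmentation R G ` carrier RG" using const_in[OF d] by (metis imageI)
  qed
qed (use augmentation_closed in auto)

section \<open>Group elements of infinite order\<close>

lemma basis_in: "gr_basis R G g \<in> carrier RG"
  by (rule group_ring_memI[of "{g}"]) (auto simp: gr_basis_def)

lemma basis_mult_coeff:
  assumes g: "g \<in> carrier G" and "f \<in> carrier RG" "x \<in> carrier G"
  shows "(gr_basis R G g \<otimes>\<^bsub>RG\<^esub> f) x = f (inv\<^bsub>G\<^esub> g \<otimes>\<^bsub>G\<^esub> x)"
proof -
  have "(gr_basis R G g \<otimes>\<^bsub>RG\<^esub> f) x
      = (\<Oplus>\<^bsub>R\<^esub>y\<in>{g}. gr_basis R G g y \<otimes>\<^bsub>R\<^esub> f (inv\<^bsub>G\<^esub> y \<otimes>\<^bsub>G\<^esub> x))"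
    using assms basis_in by (intro mult_coeff) (auto simp: gr_supp_def gr_basis_def split: if_splits)
  then show ?thesis using assms coeff_closed by (simp add: gr_basis_def)
qed

text \<open>The equation says that c is constant on orbits of left translation by the inverse of g.
  These orbits are infinite, and a finitely supported function that is constant on them
  vanishes.\<close>

lemma one_minus_basis_left_regular:
  assumes g: "g \<in> carrier G" "G.ord g = 0" and c: "c \<in> carrier RG"
    and z: "(\<one>\<^bsub>RG\<^esub> \<ominus>\<^bsub>RG\<^esub> gr_basis R G g) \<otimes>\<^bsub>RG\<^esub> c = \<zero>\<^bsub>RG\<^esub>"
  shows "c = \<zero>\<^bsub>RG\<^esub>"
proof (rule group_ring_eqI[OF c])
  fix x assume x: "x \<in> carrier G"
  let ?i = "inv\<^bsub>G\<^esub> g"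
  have i: "?i \<in> carrier G" "G.ord ?i = 0" using g by simp_all
  have "c \<ominus>\<^bsub>RG\<^esub> gr_basis R G g \<otimes>\<^bsub>RG\<^esub> c = \<zero>\<^bsub>RG\<^esub>"
    using z c basis_in by (simp add: RG.minus_eq RG.l_distr RG.l_minus)
  then have "c = gr_basis R G g \<otimes>\<^bsub>RG\<^esub> c" using c basis_in by simp
  then have shift: "c (?i \<otimes>\<^bsub>G\<^esub> y) = c y" if "y \<in> carrier G" for y
    using basis_mult_coeff[OF g(1) c that] by simp
  have orbit: "c (?i [^]\<^bsub>G\<^esub> n \<otimes>\<^bsub>G\<^esub> x) = c x" for n :: nat
  proof (induction n)
    case (Suc n)
    have "?i [^]\<^bsub>G\<^esub> Suc n \<otimes>\<^bsub>G\<^esub> x = ?i \<otimes>\<^bsub>G\<^esub> (?i [^]\<^bsub>G\<^esub> n \<otimes>\<^bsub>G\<^esub> x)"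
      using G.nat_pow_Suc2[OF i(1), of n] i x by (simp add: G.m_assoc)
    then show ?case using shift[of "?i [^]\<^bsub>G\<^esub> n \<otimes>\<^bsub>G\<^esub> x"] i x Suc by simp
  qed (use x in simp)
  have "inj (\<lambda>n::nat. ?i [^]\<^bsub>G\<^esub> n \<otimes>\<^bsub>G\<^esub> x)"
  proof (rule injI)
    fix m n :: nat assume "?i [^]\<^bsub>G\<^esub> m \<otimes>\<^bsub>G\<^esub> x = ?i [^]\<^bsub>G\<^esub> n \<otimes>\<^bsub>G\<^esub> x"
    then have "?i [^]\<^bsub>G\<^esub> m = ?i [^]\<^bsub>G\<^esub> n" using i(1) x by simp
    then have "?i [^]\<^bsub>G\<^esub> int m = ?i [^]\<^bsub>G\<^esub> int n" by (simp add: int_pow_int)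
    then show "m = n" using G.int_pow_eq[OF i(1), of "int m" "int n"] i(2) by simp
  qed
  then have inf: "infinite (range (\<lambda>n::nat. ?i [^]\<^bsub>G\<^esub> n \<otimes>\<^bsub>G\<^esub> x))" by (rule range_inj_infinite)
  have "c x = \<zero>\<^bsub>R\<^esub>"
  proof (rule ccontr)
    assume "c x \<noteq> \<zero>\<^bsub>R\<^esub>"
    then have "range (\<lambda>n::nat. ?i [^]\<^bsub>G\<^esub> n \<otimes>\<^bsub>G\<^esub> x) \<subseteq> supp c"
      using orbit i x by (auto simp: gr_supp_def)
    then show False using inf finite_supp[OF c] finite_subset by blast
  qed
  then show "c x = \<zero>\<^bsub>RG\<^esub> x" using x by (simp add: zero_coeff)
qed (rule zero_in)

text \<open>For \<open>g\<close> of infinite order, \<open>1 - g\<close> is not a left zero divisor, so \<open>u (1 - g) = e + b\<close>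
  forces \<open>e = 1\<close>; then \<open>1 - g\<close> is a unit, although its augmentation vanishes.\<close>

lemma torsion_if_strongly_unit_nil_clean:
  assumes nt: "\<one>\<^bsub>R\<^esub> \<noteq> \<zero>\<^bsub>R\<^esub>" and sunc: "strongly_unit_nil_clean RG"
  shows "torsion_group G"
  unfolding torsion_group_def
proof (intro ballI notI)
  fix g assume g: "g \<in> carrier G" "G.ord g = 0"
  interpret aug: ring_hom_ring RG R "gr_augmentation R G" by (rule augmentation_hom)
  define t where "t = \<one>\<^bsub>RG\<^esub> \<ominus>\<^bsub>RG\<^esub> gr_basis R G g"
  have t: "t \<in> carrier RG" using basis_in by (simp add: t_def)
  have "gr_augmentation R G (gr_basis R G g) = \<one>\<^bsub>R\<^esub>"
    by (rule augmentation_singleton[of g]) (use g basis_in in \<open>auto simp: gr_basis_def\<close>)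
  then have aug_t: "gr_augmentation R G t = \<zero>\<^bsub>R\<^esub>"
    using basis_in by (simp add: t_def RG.minus_eq R.r_neg)
  obtain u where u: "u \<in> Units RG" "strongly_nil_clean RG (u \<otimes>\<^bsub>RG\<^esub> t)"
    using sunc t by (auto simp: strongly_unit_nil_clean_def)
  have uc: "u \<in> carrier RG" using u(1) by auto
  obtain e b where e: "e \<in> carrier RG" "e \<otimes>\<^bsub>RG\<^esub> e = e" and b: "b \<in> carrier RG" "nilpotent RG b"
    and eb: "e \<otimes>\<^bsub>RG\<^esub> b = b \<otimes>\<^bsub>RG\<^esub> e" and sum: "u \<otimes>\<^bsub>RG\<^esub> t = e \<oplus>\<^bsub>RG\<^esub> b"
    using u(2) unfolding strongly_nil_clean_def by blast
  obtain n :: nat where n: "b [^]\<^bsub>RG\<^esub> n = \<zero>\<^bsub>RG\<^esub>" using b(2) by (auto simp: nilpotent_def)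
  define f where "f = \<one>\<^bsub>RG\<^esub> \<ominus>\<^bsub>RG\<^esub> e"
  have f: "f \<in> carrier RG" "e \<otimes>\<^bsub>RG\<^esub> f = \<zero>\<^bsub>RG\<^esub>"
    using e by (simp_all add: f_def RG.minus_eq RG.r_distr RG.r_minus RG.r_neg)
  have ebn: "e \<otimes>\<^bsub>RG\<^esub> b [^]\<^bsub>RG\<^esub> j = b [^]\<^bsub>RG\<^esub> j \<otimes>\<^bsub>RG\<^esub> e" for j :: nat
  proof (induction j)
    case (Suc j)
    have "e \<otimes>\<^bsub>RG\<^esub> b [^]\<^bsub>RG\<^esub> Suc j = (e \<otimes>\<^bsub>RG\<^esub> b [^]\<^bsub>RG\<^esub> j) \<otimes>\<^bsub>RG\<^esub> b"
      using e(1) b(1) by (simp add: RG.m_assoc)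
    also have "\<dots> = b [^]\<^bsub>RG\<^esub> j \<otimes>\<^bsub>RG\<^esub> (e \<otimes>\<^bsub>RG\<^esub> b)" unfolding Suc using e(1) b(1) by (simp add: RG.m_assoc)
    finally show ?case unfolding eb using e(1) b(1) by (simp add: RG.m_assoc)
  qed (use e(1) in simp)
  \<comment> \<open>Put c = b^j f. Then e c = b^j e f = 0 and b c = 0, so u t = e + b kills c; hence
    t c = 0 and regularity of t gives c = 0.\<close>
  have step: "b [^]\<^bsub>RG\<^esub> j \<otimes>\<^bsub>RG\<^esub> f = \<zero>\<^bsub>RG\<^esub>" if z: "b [^]\<^bsub>RG\<^esub> Suc j \<otimes>\<^bsub>RG\<^esub> f = \<zero>\<^bsub>RG\<^esub>" for j :: nat
  proof -
    let ?c = "b [^]\<^bsub>RG\<^esub> j \<otimes>\<^bsub>RG\<^esub> f"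
    have c: "?c \<in> carrier RG" using b(1) f(1) by simp
    have ec: "e \<otimes>\<^bsub>RG\<^esub> ?c = \<zero>\<^bsub>RG\<^esub>"
    proof -
      have "e \<otimes>\<^bsub>RG\<^esub> ?c = (e \<otimes>\<^bsub>RG\<^esub> b [^]\<^bsub>RG\<^esub> j) \<otimes>\<^bsub>RG\<^esub> f" using e(1) b(1) f(1) by (simp add: RG.m_assoc)
      also have "\<dots> = b [^]\<^bsub>RG\<^esub> j \<otimes>\<^bsub>RG\<^esub> (e \<otimes>\<^bsub>RG\<^esub> f)" unfolding ebn using e(1) b(1) f(1) by (simp add: RG.m_assoc)
      finally show ?thesis unfolding f(2) using b(1) by simp
    qed
    have bc: "b \<otimes>\<^bsub>RG\<^esub> ?c = \<zero>\<^bsub>RG\<^esub>"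
      using z b(1) f(1) unfolding RG.nat_pow_Suc2[OF b(1)] by (simp add: RG.m_assoc)
    have "u \<otimes>\<^bsub>RG\<^esub> (t \<otimes>\<^bsub>RG\<^esub> ?c) = (u \<otimes>\<^bsub>RG\<^esub> t) \<otimes>\<^bsub>RG\<^esub> ?c"
      using uc t c by (simp add: RG.m_assoc)
    also have "\<dots> = \<zero>\<^bsub>RG\<^esub>" unfolding sum using e(1) b(1) c by (simp add: RG.l_distr ec bc)
    finally have "inv\<^bsub>RG\<^esub> u \<otimes>\<^bsub>RG\<^esub> (u \<otimes>\<^bsub>RG\<^esub> (t \<otimes>\<^bsub>RG\<^esub> ?c)) = \<zero>\<^bsub>RG\<^esub>" using u(1) by simp
    then have "t \<otimes>\<^bsub>RG\<^esub> ?c = \<zero>\<^bsub>RG\<^esub>" using u(1) uc t c by (simp add: RG.m_assoc[symmetric])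
    then show ?thesis using one_minus_basis_left_regular[OF g c] by (simp add: t_def)
  qed
  \<comment> \<open>Starting from b^n = 0, the exponent descends to zero, leaving f = 0 and e =
    1.\<close>
  have "b [^]\<^bsub>RG\<^esub> j \<otimes>\<^bsub>RG\<^esub> f = \<zero>\<^bsub>RG\<^esub> \<Longrightarrow> f = \<zero>\<^bsub>RG\<^esub>" for j :: nat
    by (induction j) (use f(1) step in auto)
  then have "f = \<zero>\<^bsub>RG\<^esub>" using n f(1) by (metis RG.l_null)
  then have "e = \<one>\<^bsub>RG\<^esub>" using e(1) by (simp add: f_def)
  then have "u \<otimes>\<^bsub>RG\<^esub> t \<in> Units RG" using RG.one_plus_nilpotent_Units[OF b(2)] sum by simp
  then have "gr_augmentation R G (u \<otimes>\<^bsub>RG\<^esub> t) \<in> Units R" by (rule aug.hom_Units)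
  then have "\<zero>\<^bsub>R\<^esub> \<in> Units R" using uc t aug_t by simp
  then have "\<one>\<^bsub>R\<^esub> = \<zero>\<^bsub>R\<^esub>" using R.Units_r_inv R.Units_inv_closed R.l_null by metis
  then show False using nt by simp
qed

end

text \<open>Over the zero ring every group ring is zero and hence strongly unit nil-clean, whatever
  the group; \<open>\<one> \<noteq> \<zero>\<close> rules out these counterexamples to
  torsion.\<close>

theorem theorem4p8:
  fixes R :: "('a, 'm) ring_scheme" and G :: "('g, 'n) monoid_scheme"
  assumes "ring R" and "group G"
  shows "(weakly_2_primal R \<and> strongly_unit_nil_clean R \<and> locally_finite_group G
            \<longrightarrow> strongly_unit_nil_clean (group_ring R G)) \<and>
         (\<one>\<^bsub>R\<^esub> \<noteq> \<zero>\<^bsub>R\<^esub> \<and> strongly_unit_nil_clean (group_ring R G)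
            \<longrightarrow> strongly_unit_nil_clean R \<and> torsion_group G)"
proof -
  interpret group_ring_setup R G using assms by (simp add: group_ring_setup_def)
  show ?thesis
    using strongly_unit_nil_clean_group_ring[OF assms] torsion_if_strongly_unit_nil_clean
      ring_hom_ring.surj_strongly_unit_nil_clean[OF augmentation_hom augmentation_surj] by blast
qed

end
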